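(* Let $\Lambda=\langle a,b,c,d\mid [a,b][c,d]=1\rangle$ be the fundamental group of the closed surface of genus $2$. There exists a sequence $(\pi_n)$ of probability measures on $\Lambda$ such that: (1) $\pi_n$ is supported on the union of the spheres of radius $n$ and radius $n+1$ centered at the identity in $\Lambda$ (with respect to the word metric); (2) $\pi_n$ is mean ergodic in $L^1$ in the following sense: if $\Lambda\curvearrowright(X,\mu)$ is any probability-measure-preserving action and $f\in L^1(X,\mu)$, then the averages $\pi_n(f)\in L^1(X,\mu)$ defined by $$\pi_n(f)(x)=\sum_{g\in\Lambda}\pi_n(g)f(g^{-1}x)$$ converge in $L^1(X,\mu)$ as $n\to\infty$ to $\mathbb{E}[f|\Lambda]$, the conditional expectation of $f$ on the sigma-algebra of $\Lambda$-invariant measurable subsets of $X$.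
   Context: The word metric on $\Lambda$ is taken with respect to the generating set $S=\{a,b,c,d,a^{-1},b^{-1},c^{-1},d^{-1}\}$. The sequence $(\pi_n)$ does not depend on the action or on $f$. *)

theory Defs
  imports "HOL-Probability.Probability" "HOL-Algebra.Group_Action"
begin

section \<open>The genus two surface group\<close>

datatype surface_gen = Gen_a | Gen_b | Gen_c | Gen_d

text \<open>A letter is a generator together with a sign; \<open>(x, True)\<close> stands for \<open>x\<close> and
  \<open>(x, False)\<close> for its formal inverse.\<close>

type_synonym surface_word = "(surface_gen \<times> bool) list"

definition word_inv :: "surface_word \<Rightarrow> surface_word" where
  "word_inv w = rev (map (\<lambda>(x, s). (x, \<not> s)) w)"

definition word_comm :: "surface_word \<Rightarrow> surface_word \<Rightarrow> surface_word" where
  "word_comm u v = u @ v @ word_inv u @ word_inv v"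

definition surface_relator :: surface_word where
  "surface_relator =
     word_comm [(Gen_a, True)] [(Gen_b, True)] @ word_comm [(Gen_c, True)] [(Gen_d, True)]"

text \<open>The congruence on words whose quotient is the group presented by the four generators and
  the single relator: it is generated by free cancellation and by deleting the relator.\<close>

inductive surface_eq :: "surface_word \<Rightarrow> surface_word \<Rightarrow> bool" where
  refl: "surface_eq u u"
| sym: "surface_eq u v \<Longrightarrow> surface_eq v u"
| trans: "surface_eq u v \<Longrightarrow> surface_eq v w \<Longrightarrow> surface_eq u w"
| cancel: "surface_eq (u @ [(x, s), (x, \<not> s)] @ v) (u @ v)"
| relator: "surface_eq (u @ surface_relator @ v) (u @ v)"

lemma surface_eq_context: "surface_eq u v \<Longrightarrow> surface_eq (p @ u @ q) (p @ v @ q)"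
proof (induction rule: surface_eq.induct)
  case (refl u)
  show ?case by (rule surface_eq.refl)
next
  case (sym u v)
  show ?case by (rule surface_eq.sym[OF sym.IH])
next
  case (trans u v w)
  show ?case by (rule surface_eq.trans[OF trans.IH])
next
  case (cancel u x s v)
  show ?case using surface_eq.cancel[of "p @ u" x s "v @ q"] by simp
next
  case (relator u v)
  show ?case using surface_eq.relator[of "p @ u" "v @ q"] by simp
qed

lemma surface_eq_append:
  assumes "surface_eq u u'" "surface_eq v v'"
  shows "surface_eq (u @ v) (u' @ v')"
proof (rule surface_eq.trans)
  show "surface_eq (u @ v) (u' @ v)"
    using surface_eq_context[OF assms(1), of "[]" v] by simp
  show "surface_eq (u' @ v) (u' @ v')"
    using surface_eq_context[OF assms(2), of u' "[]"] by simp
qed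

lemma word_inv_right: "surface_eq (w @ word_inv w) []"
proof (induction w)
  case Nil
  show ?case by (simp add: word_inv_def surface_eq.refl)
next
  case (Cons l w)
  obtain x s where l: "l = (x, s)" by (cases l)
  have "surface_eq ([l] @ (w @ word_inv w) @ [(x, \<not> s)]) ([l] @ [] @ [(x, \<not> s)])"
    by (rule surface_eq_context[OF Cons.IH])
  moreover have "surface_eq ([l] @ [] @ [(x, \<not> s)]) []"
    using surface_eq.cancel[of "[]" x s "[]"] by (simp add: l)
  moreover have "(l # w) @ word_inv (l # w) = [l] @ (w @ word_inv w) @ [(x, \<not> s)]"
    by (simp add: word_inv_def l)
  ultimately show ?case by (simp only: surface_eq.trans[of _ "[l] @ [] @ [(x, \<not> s)]"])
qed

lemma word_inv_invol: "word_inv (word_inv w) = w"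
  by (simp add: word_inv_def rev_map case_prod_beta' comp_def)

lemma word_inv_left: "surface_eq (word_inv w @ w) []"
  using word_inv_right[of "word_inv w"] by (simp add: word_inv_invol)

quotient_type surface_elt = surface_word / surface_eq
  by (intro equivpI reflpI sympI transpI)
     (fact surface_eq.refl, erule surface_eq.sym, erule (1) surface_eq.trans)

lift_definition surface_mult :: "surface_elt \<Rightarrow> surface_elt \<Rightarrow> surface_elt" is "(@)"
  by (rule surface_eq_append)

lift_definition surface_one :: surface_elt is "[]" .

lift_definition surface_letter :: "surface_gen \<times> bool \<Rightarrow> surface_elt" is "\<lambda>l. [l]" .

definition surface_group :: "surface_elt monoid" where
  "surface_group = \<lparr>carrier = UNIV, mult = surface_mult, one = surface_one\<rparr>"

lemma group_surface_group: "group surface_group"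
proof -
  have 1: "surface_mult (surface_mult x y) z = surface_mult x (surface_mult y z)" for x y z
    by transfer (simp add: surface_eq.refl)
  have 2: "surface_mult surface_one x = x" for x
    by transfer (simp add: surface_eq.refl)
  have 3: "\<exists>y. surface_mult y x = surface_one" for x
    by transfer (rule exI, rule word_inv_left)
  show ?thesis
    by (rule groupI) (simp_all add: surface_group_def 1 2 3)
qed

text \<open>The symmetric generating set: the four generators and their inverses.\<close>

definition surface_gens :: "surface_elt set" where
  "surface_gens = range surface_letter"

lemma surface_letter_inv:
  "surface_letter (x, False) = inv\<^bsub>surface_group\<^esub> surface_letter (x, True)"
proof -
  interpret group surface_group by (rule group_surface_group)
  have "surface_mult (surface_letter (x, False)) (surface_letter (x, True)) = surface_one"
    by transfer (use surface_eq.cancel[of "[]" _ False "[]"] in simp)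
  then have "inv\<^bsub>surface_group\<^esub> surface_letter (x, True) = surface_letter (x, False)"
    by (intro inv_equality) (simp_all add: surface_group_def)
  then show ?thesis by simp
qed

section \<open>Word metrics\<close>

text \<open>\<open>LEAST\<close> is meaningful only if \<open>S\<close> generates \<open>G\<close> as a monoid, as is the case for
  a symmetric generating set.\<close>

definition word_norm :: "('g, 'b) monoid_scheme \<Rightarrow> 'g set \<Rightarrow> 'g \<Rightarrow> nat" where
  "word_norm G S g =
     (LEAST n. \<exists>ss. length ss = n \<and> set ss \<subseteq> S \<and> foldr (mult G) ss \<one>\<^bsub>G\<^esub> = g)"

definition word_dist :: "('g, 'b) monoid_scheme \<Rightarrow> 'g set \<Rightarrow> 'g \<Rightarrow> 'g \<Rightarrow> nat" where
  "word_dist G S g h = word_norm G S (inv\<^bsub>G\<^esub> g \<otimes>\<^bsub>G\<^esub> h)"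

definition word_sphere :: "('g, 'b) monoid_scheme \<Rightarrow> 'g set \<Rightarrow> nat \<Rightarrow> 'g set" where
  "word_sphere G S n = {g \<in> carrier G. word_dist G S \<one>\<^bsub>G\<^esub> g = n}"

lemma surface_gens_generate:
  "\<exists>ss. set ss \<subseteq> surface_gens \<and> foldr (mult surface_group) ss \<one>\<^bsub>surface_group\<^esub> = g"
proof -
  have "foldr surface_mult (map surface_letter w) surface_one = abs_surface_elt w" for w
    by (induction w)
       (simp_all add: surface_one.abs_eq surface_letter.abs_eq surface_mult.abs_eq)
  moreover obtain w where "g = abs_surface_elt w"
    using Quotient_abs_rep[OF Quotient_surface_elt, of g] by metis
  ultimately show ?thesis
    by (intro exI[of _ "map surface_letter w"]) (auto simp: surface_group_def surface_gens_def)
qed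

section \<open>Mean ergodicity\<close>

definition pmp_action ::
  "('g, 'b) monoid_scheme \<Rightarrow> 'x measure \<Rightarrow> ('g \<Rightarrow> 'x \<Rightarrow> 'x) \<Rightarrow> bool" where
  "pmp_action G M \<phi> \<longleftrightarrow> prob_space M \<and> group_action G (space M) \<phi> \<and>
     (\<forall>g\<in>carrier G. \<phi> g \<in> measurable M M \<and> distr M M (\<phi> g) = M)"

definition invariant_algebra ::
  "('g, 'b) monoid_scheme \<Rightarrow> 'x measure \<Rightarrow> ('g \<Rightarrow> 'x \<Rightarrow> 'x) \<Rightarrow> 'x measure" where
  "invariant_algebra G M \<phi> = sigma (space M) {A \<in> sets M. \<forall>g\<in>carrier G. \<phi> g ` A = A}"

lemma subalgebra_invariant_algebra: "subalgebra M (invariant_algebra G M \<phi>)"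
proof -
  have "{A \<in> sets M. \<forall>g\<in>carrier G. \<phi> g ` A = A} \<subseteq> Pow (space M)"
    using sets.sets_into_space by auto
  then show ?thesis
    unfolding subalgebra_def invariant_algebra_def by (auto intro!: sets.sigma_sets_subset)
qed

definition group_average ::
  "('g, 'b) monoid_scheme \<Rightarrow> 'g pmf \<Rightarrow> ('g \<Rightarrow> 'x \<Rightarrow> 'x) \<Rightarrow> ('x \<Rightarrow> real) \<Rightarrow> 'x \<Rightarrow> real" where
  "group_average G p \<phi> f x = (\<Sum>\<^sub>\<infinity>g\<in>carrier G. pmf p g * f (\<phi> (inv\<^bsub>G\<^esub> g) x))"

definition L1_mean_ergodic_on ::
  "('g, 'b) monoid_scheme \<Rightarrow> (nat \<Rightarrow> 'g pmf) \<Rightarrow> 'x measure \<Rightarrow> ('g \<Rightarrow> 'x \<Rightarrow> 'x) \<Rightarrow> bool" where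
  "L1_mean_ergodic_on G \<pi> M \<phi> \<longleftrightarrow>
     (\<forall>f :: 'x \<Rightarrow> real. integrable M f \<longrightarrow>
        (\<forall>n. integrable M (group_average G (\<pi> n) \<phi> f)) \<and>
        (\<lambda>n. \<integral>x. \<bar>group_average G (\<pi> n) \<phi> f x - real_cond_exp M (invariant_algebra G M \<phi>) f x\<bar> \<partial>M)
          \<longlonglongrightarrow> 0)"

text \<open>The sequence of measures has to be one and the same for actions on spaces of every type,
  but HOL cannot quantify over types below an existential quantifier: in
  \<open>\<exists>\<pi>. \<forall>(M :: 'x measure) \<phi>. \<dots>\<close> the witness could depend on \<open>'x\<close>. The witness is therefore
  named by a constant without type parameters. It is chosen to work for actions on spaces over
  one fixed type; the type \<open>surface_elt \<Rightarrow> real\<close> is large enough, since for an arbitrary action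
  and an integrable \<open>f\<close> the orbit map \<open>x \<mapsto> (g \<mapsto> f (g\<^sup>-\<^sup>1 x))\<close> is a factor map onto
  a shift action on this type. Nothing is known about the constant without proving
  that such a sequence exists.\<close>

definition surface_seq :: "nat \<Rightarrow> surface_elt pmf" where
  "surface_seq = (SOME \<pi>.
     (\<forall>n. set_pmf (\<pi> n) \<subseteq> word_sphere surface_group surface_gens n
                         \<union> word_sphere surface_group surface_gens (n + 1)) \<and>
     (\<forall>(M :: (surface_elt \<Rightarrow> real) measure) \<phi>.
        pmp_action surface_group M \<phi> \<longrightarrow> L1_mean_ergodic_on surface_group \<pi> M \<phi>))"

end

theory Submission
  imports Defs "HOL-Algebra.Generated_Groups"
begin

text \<open>
  The measures are laws of a random walk whose trajectories are geodesics. Folding the generators,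
  \<open>a, b \<mapsto> x\<close> and \<open>c, d \<mapsto> y\<close>, kills the relator, so it defines a homomorphism from \<open>\<Lambda>\<close> to the
  free group on \<open>x\<close> and \<open>y\<close> that maps letters to letters. A word whose folded image is freely
  reduced is therefore geodesic (\<open>word_norm_folded_reduced\<close>). Let \<open>E\<close> be the set of elements given
  by such words of length 4 that begin and end with a letter over \<open>x\<close>, and let \<open>F\<close> be the same for
  \<open>y\<close>. Both sets are symmetric, and every product that takes its factors alternately from \<open>E\<close>
  and \<open>F\<close> is geodesic, because nothing cancels between an \<open>x\<close> and a \<open>y\<close>.

  Fix a bounded \<open>f\<close>, let \<open>w\<^sub>0 = f\<close>, and let \<open>w\<^sub>k\<^sub>+\<^sub>1\<close> be the average of \<open>g w\<^sub>k\<close> over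
  \<open>g\<close> in \<open>E\<close> for even \<open>k\<close> and in \<open>F\<close> for odd \<open>k\<close>. The norms of the \<open>w\<^sub>k\<close> in \<open>L\<^sup>2\<close> decrease, and
  the drop of the squared norm at step \<open>k\<close> is the variance of the vectors \<open>g w\<^sub>k\<close>
  (\<open>variance_identity\<close>). Hence every single \<open>g\<close> in the set used at step \<open>k\<close> takes \<open>w\<^sub>k\<close>
  almost to \<open>w\<^sub>k\<^sub>+\<^sub>1\<close>, and by symmetry of the set also \<open>w\<^sub>k\<^sub>+\<^sub>1\<close> almost back to \<open>w\<^sub>k\<close>. So products
  of two elements of \<open>E\<close>, or of two elements of \<open>F\<close>, asymptotically fix \<open>w\<^sub>k\<close>. They generate
  all elements of even word length (\<open>block_group_even\<close>), among them \<open>E\<close> and \<open>F\<close>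
  themselves, and so \<open>w\<^sub>k\<^sub>+\<^sub>1 - w\<^sub>k\<close> tends to 0. The averaging operators are self-adjoint, so the
  inner product of \<open>w\<^sub>m\<close> and \<open>w\<^sub>n\<close> depends only on \<open>m + n\<close> when \<open>m + n\<close> is odd. It then equals
  the inner product of two adjacent terms, which is close to the limit of the squared norms. This
  makes \<open>w\<^sub>k\<close> a Cauchy sequence, and its limit \<open>h\<close> is invariant under all elements of even length
  (\<open>alternating_limit\<close>).

  The even elements have index 2 in \<open>\<Lambda>\<close>, and \<open>h\<close> may differ from \<open>a h\<close>: the parity of the
  word length is a homomorphism from \<open>\<Lambda>\<close> onto a group of order 2. This is why two consecutive
  spheres are needed. Multiplying the walk on the left by a power of \<open>a\<close> produces geodesics of any prescribed length \<open>m\<close>, and the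
  corresponding averages tend to \<open>h\<close> along even \<open>m\<close> and to \<open>a h\<close> along odd \<open>m\<close>. The mean of the
  averages for \<open>n\<close> and \<open>n + 1\<close> tends to \<open>(h + a h) / 2\<close>, which is \<open>\<Lambda>\<close>-invariant. Averaging over
  the group preserves integrals over invariant sets, so an invariant limit can only be the
  conditional expectation (\<open>invariant_limit_is_inv_exp\<close>). Bounded functions are dense in \<open>L\<^sup>1\<close> and
  all operators involved are contractions, which gives the result for integrable \<open>f\<close>.

  The constant \<open>surface_seq\<close> is specified only by its behaviour for actions on spaces of functions
  \<open>\<Lambda> \<Rightarrow> real\<close>. For an integrable \<open>f\<close> on an arbitrary space, the orbit map
  \<open>x \<mapsto> (g \<mapsto> f (g\<^sup>-\<^sup>1 x))\<close> is equivariant for the shift on that function space, and it pulls the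
  limit found there back to an invariant limit of the averages of \<open>f\<close>, which is again the
  conditional expectation (\<open>L1_mean_ergodic_transfer\<close>).
\<close>

section \<open>Averages over a measure preserving action\<close>

locale pmp_system = prob_space M + group_action G "space M" \<phi>
  for G (structure) and M :: "'x measure" and \<phi> +
  assumes measurable_act [measurable]: "g \<in> carrier G \<Longrightarrow> \<phi> g \<in> measurable M M"
    and distr_act: "g \<in> carrier G \<Longrightarrow> distr M M (\<phi> g) = M"
begin

sublocale G: group G
  using group_hom by (rule group_hom.axioms(1))

definition translate :: "'a \<Rightarrow> ('x \<Rightarrow> real) \<Rightarrow> 'x \<Rightarrow> real" where
  "translate g f x = f (\<phi> (inv g) x)"

definition fin_supp :: "'a pmf \<Rightarrow> bool" where
  "fin_supp p \<longleftrightarrow> finite (set_pmf p) \<and> set_pmf p \<subseteq> carrier G"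

definition avg :: "'a pmf \<Rightarrow> ('x \<Rightarrow> real) \<Rightarrow> 'x \<Rightarrow> real" where
  "avg p f x = (\<Sum>g\<in>set_pmf p. pmf p g * translate g f x)"

lemma group_average_eq_avg:
  assumes "fin_supp p"
  shows "group_average G p \<phi> f = avg p f"
proof
  fix x
  have "group_average G p \<phi> f x = (\<Sum>\<^sub>\<infinity>g\<in>set_pmf p. pmf p g * f (\<phi> (inv g) x))"
    unfolding group_average_def using assms
    by (intro infsum_cong_neutral) (auto simp: fin_supp_def set_pmf_iff)
  then show "group_average G p \<phi> f x = avg p f x"
    using assms by (simp add: avg_def translate_def fin_supp_def)
qed

lemma act_closed: "g \<in> carrier G \<Longrightarrow> x \<in> space M \<Longrightarrow> \<phi> g x \<in> space M"
  using element_image by blast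

lemma act_one: "x \<in> space M \<Longrightarrow> \<phi> \<one> x = x"
  by (metis id_eq_one restrict_apply')

lemma act_inv_act: "g \<in> carrier G \<Longrightarrow> x \<in> space M \<Longrightarrow> \<phi> (inv g) (\<phi> g x) = x"
  by (rule orbit_sym_aux) auto

lemma act_act_inv: "g \<in> carrier G \<Longrightarrow> x \<in> space M \<Longrightarrow> \<phi> g (\<phi> (inv g) x) = x"
  using act_inv_act[of "inv g" x] by simp

lemma translate_mult:
  assumes "g \<in> carrier G" "h \<in> carrier G" "x \<in> space M"
  shows "translate g (translate h f) x = translate (g \<otimes> h) f x"
  using assms by (simp add: translate_def composition_rule G.inv_mult_group)

lemma translate_measurable [measurable]:
  assumes "g \<in> carrier G" "f \<in> borel_measurable M"
  shows "translate g f \<in> borel_measurable M"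
proof -
  have [measurable]: "\<phi> (inv g) \<in> measurable M M" using assms by (simp add: measurable_act)
  note [measurable] = assms(2)
  show ?thesis unfolding translate_def by measurable
qed

lemma translate_integrable:
  assumes "g \<in> carrier G" "integrable M f"
  shows "integrable M (translate g f)"
proof -
  have "integrable (distr M M (\<phi> (inv g))) f" using assms by (simp add: distr_act)
  then show ?thesis unfolding translate_def
    by (rule integrable_distr[rotated]) (simp add: assms measurable_act)
qed

lemma integral_translate:
  assumes "g \<in> carrier G" "f \<in> borel_measurable M"
  shows "(\<integral>x. translate g f x \<partial>M) = (\<integral>x. f x \<partial>M)"
proof -
  have "(\<integral>x. f x \<partial>M) = (\<integral>x. f x \<partial>distr M M (\<phi> (inv g)))"
    using assms by (simp add: distr_act)
  also have "\<dots> = (\<integral>x. translate g f x \<partial>M)"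
    unfolding translate_def using assms by (subst integral_distr) (simp_all add: measurable_act)
  finally show ?thesis by simp
qed

lemma AE_act:
  assumes "g \<in> carrier G" "AE x in M. P x"
  shows "AE x in M. P (\<phi> g x)"
proof -
  have "AE x in distr M M (\<phi> g). P x" using assms by (simp only: distr_act)
  then show ?thesis by (rule AE_distrD[OF measurable_act[OF assms(1)]])
qed

lemma avg_measurable [measurable]:
  assumes "fin_supp p" "f \<in> borel_measurable M"
  shows "avg p f \<in> borel_measurable M"
proof -
  have "(\<lambda>x. \<Sum>g\<in>set_pmf p. pmf p g * translate g f x) \<in> borel_measurable M"
    using assms by (intro borel_measurable_sum borel_measurable_times translate_measurable)
      (auto simp: fin_supp_def)
  then show ?thesis by (simp add: avg_def [abs_def])
qed

lemma avg_integrable: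
  assumes "fin_supp p" "integrable M f"
  shows "integrable M (avg p f)"
proof -
  have "integrable M (\<lambda>x. \<Sum>g\<in>set_pmf p. pmf p g * translate g f x)"
    using assms by (intro Bochner_Integration.integrable_sum integrable_mult_right translate_integrable)
      (auto simp: fin_supp_def)
  then show ?thesis by (simp add: avg_def [abs_def])
qed

lemma avg_diff: "avg p (\<lambda>x. f x - h x) x = avg p f x - avg p h x"
  by (simp add: avg_def translate_def sum_subtractf right_diff_distrib)

lemma L1_translate:
  assumes "g \<in> carrier G" "f \<in> borel_measurable M" "h \<in> borel_measurable M"
  shows "(\<integral>x. \<bar>translate g f x - translate g h x\<bar> \<partial>M) = (\<integral>x. \<bar>f x - h x\<bar> \<partial>M)"
  using integral_translate[OF assms(1), of "\<lambda>x. \<bar>f x - h x\<bar>"] assms(2,3)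
  by (simp add: translate_def)

lemma L1_avg_le:
  assumes p: "fin_supp p" and f: "integrable M f"
  shows "(\<integral>x. \<bar>avg p f x\<bar> \<partial>M) \<le> (\<integral>x. \<bar>f x\<bar> \<partial>M)"
proof -
  have g: "g \<in> carrier G" if "g \<in> set_pmf p" for g using that p by (auto simp: fin_supp_def)
  have int: "integrable M (\<lambda>x. pmf p g * \<bar>translate g f x\<bar>)" if "g \<in> set_pmf p" for g
    using translate_integrable[OF g f] that by auto
  have "(\<integral>x. \<bar>avg p f x\<bar> \<partial>M) \<le> (\<integral>x. (\<Sum>g\<in>set_pmf p. pmf p g * \<bar>translate g f x\<bar>) \<partial>M)"
  proof (rule integral_mono)
    show "integrable M (\<lambda>x. \<bar>avg p f x\<bar>)" using avg_integrable[OF p f] by simp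
    show "integrable M (\<lambda>x. \<Sum>g\<in>set_pmf p. pmf p g * \<bar>translate g f x\<bar>)"
      using int by (rule Bochner_Integration.integrable_sum)
    show "\<bar>avg p f x\<bar> \<le> (\<Sum>g\<in>set_pmf p. pmf p g * \<bar>translate g f x\<bar>)" for x
      unfolding avg_def by (rule order_trans[OF sum_abs]) (simp add: abs_mult)
  qed
  also have "\<dots> = (\<Sum>g\<in>set_pmf p. \<integral>x. pmf p g * \<bar>translate g f x\<bar> \<partial>M)"
    using int by (rule Bochner_Integration.integral_sum)
  also have "\<dots> = (\<Sum>g\<in>set_pmf p. pmf p g * (\<integral>x. \<bar>f x\<bar> \<partial>M))"
  proof (rule sum.cong)
    fix h assume "h \<in> set_pmf p"
    then show "(\<integral>x. pmf p h * \<bar>translate h f x\<bar> \<partial>M) = pmf p h * (\<integral>x. \<bar>f x\<bar> \<partial>M)"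
      using integral_translate[OF g, of h "\<lambda>x. \<bar>f x\<bar>"] f by (simp add: translate_def)
  qed simp
  also have "\<dots> = (\<integral>x. \<bar>f x\<bar> \<partial>M)"
    using p by (simp add: sum_distrib_right[symmetric] sum_pmf_eq_1 fin_supp_def)
  finally show ?thesis .
qed

lemma invariant_iff:
  assumes "A \<subseteq> space M"
  shows "(\<forall>g\<in>carrier G. \<phi> g ` A = A) \<longleftrightarrow>
    (\<forall>g\<in>carrier G. \<forall>x\<in>space M. \<phi> g x \<in> A \<longleftrightarrow> x \<in> A)" (is "?l \<longleftrightarrow> ?r")
proof
  assume L: ?l
  show ?r
  proof (intro ballI)
    fix g x assume g: "g \<in> carrier G" and x: "x \<in> space M"
    have "x \<in> A \<Longrightarrow> \<phi> g x \<in> A" using L g by auto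
    moreover have "x \<in> A" if "\<phi> g x \<in> A"
    proof -
      have "\<phi> (inv g) (\<phi> g x) \<in> A" using that L g by (metis G.inv_closed imageI)
      then show ?thesis using act_inv_act g x by simp
    qed
    ultimately show "\<phi> g x \<in> A \<longleftrightarrow> x \<in> A" by blast
  qed
next
  assume R: ?r
  show ?l
  proof
    fix g assume g: "g \<in> carrier G"
    have "x \<in> \<phi> g ` A" if "x \<in> A" for x
    proof
      show "x = \<phi> g (\<phi> (inv g) x)" using that assms g by (simp add: act_act_inv subset_iff)
      show "\<phi> (inv g) x \<in> A" using R g that assms by blast
    qed
    then show "\<phi> g ` A = A" using R g assms by auto
  qed
qed

lemma space_invariant_algebra: "space (invariant_algebra G M \<phi>) = space M"
  using subalgebra_invariant_algebra[of M G \<phi>] by (simp add: subalgebra_def)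

lemma sets_invariant_algebra:
  "sets (invariant_algebra G M \<phi>) =
    {A \<in> sets M. \<forall>g\<in>carrier G. \<forall>x\<in>space M. \<phi> g x \<in> A \<longleftrightarrow> x \<in> A}" (is "_ = ?S")
proof -
  have eq: "{A \<in> sets M. \<forall>g\<in>carrier G. \<phi> g ` A = A} = ?S"
    using invariant_iff[OF sets.sets_into_space] by blast
  have "sigma_algebra (space M) ?S"
    unfolding sigma_algebra_iff2
  proof (intro conjI allI impI ballI)
    show "?S \<subseteq> Pow (space M)" using sets.sets_into_space by blast
    show "{} \<in> ?S" by simp
    show "space M - A \<in> ?S" if "A \<in> ?S" for A using that act_closed by auto
    show "(\<Union>i. A i) \<in> ?S" if "range A \<subseteq> ?S" for A :: "nat \<Rightarrow> 'x set"
    proof -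
      have "A i \<in> ?S" for i using that by blast
      then show ?thesis by auto
    qed
  qed
  then show ?thesis
    unfolding invariant_algebra_def eq
    by (metis (no_types, lifting) sigma_algebra.sets_measure_of_eq)
qed

lemma invariant_measurable_act:
  assumes h: "h \<in> borel_measurable (invariant_algebra G M \<phi>)"
    and g: "g \<in> carrier G" and x: "x \<in> space M"
  shows "h (\<phi> g x) = (h x :: real)"
proof -
  have "h -` {h x} \<inter> space M \<in> sets (invariant_algebra G M \<phi>)"
    using measurable_sets[OF h, of "{h x}"] by (simp add: space_invariant_algebra)
  then show ?thesis using g x by (auto simp: sets_invariant_algebra)
qed

sublocale I: finite_measure_subalgebra M "invariant_algebra G M \<phi>"
  by standard (rule subalgebra_invariant_algebra)

abbreviation inv_exp :: "('x \<Rightarrow> real) \<Rightarrow> 'x \<Rightarrow> real" where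
  "inv_exp \<equiv> real_cond_exp M (invariant_algebra G M \<phi>)"

lemma L1_inv_exp_le:
  assumes f: "integrable M f"
  shows "(\<integral>x. \<bar>inv_exp f x\<bar> \<partial>M) \<le> (\<integral>x. \<bar>f x\<bar> \<partial>M)"
proof -
  have a: "integrable M (\<lambda>x. \<bar>f x\<bar>)" using f by simp
  have "AE x in M. inv_exp f x \<le> inv_exp (\<lambda>x. \<bar>f x\<bar>) x"
    using f a by (intro I.real_cond_exp_mono) auto
  moreover have "AE x in M. inv_exp (\<lambda>x. - 1 * f x) x \<le> inv_exp (\<lambda>x. \<bar>f x\<bar>) x"
    using f a by (intro I.real_cond_exp_mono) auto
  moreover have "AE x in M. inv_exp (\<lambda>x. - 1 * f x) x = - 1 * inv_exp f x"
    by (rule I.real_cond_exp_cmult[OF f])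
  ultimately have "AE x in M. \<bar>inv_exp f x\<bar> \<le> inv_exp (\<lambda>x. \<bar>f x\<bar>) x" by eventually_elim auto
  then have "(\<integral>x. \<bar>inv_exp f x\<bar> \<partial>M) \<le> (\<integral>x. inv_exp (\<lambda>x. \<bar>f x\<bar>) x \<partial>M)"
    using I.real_cond_exp_int(1)[OF f] I.real_cond_exp_int(1)[OF a]
    by (intro integral_mono_AE) auto
  then show ?thesis using I.real_cond_exp_int(2)[OF a] by simp
qed

lemma set_integral_avg:
  assumes p: "fin_supp p" and f: "integrable M f"
    and A: "A \<in> sets (invariant_algebra G M \<phi>)"
  shows "(\<integral>x\<in>A. avg p f x \<partial>M) = (\<integral>x\<in>A. f x \<partial>M)"
proof -
  have AM: "A \<in> sets M" and inv: "\<And>g x. g \<in> carrier G \<Longrightarrow> x \<in> space M \<Longrightarrow> \<phi> g x \<in> A \<longleftrightarrow> x \<in> A"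
    using A by (auto simp: sets_invariant_algebra)
  have g: "g \<in> carrier G" if "g \<in> set_pmf p" for g using that p by (auto simp: fin_supp_def)
  let ?F = "\<lambda>x. indicator A x * f x"
  have F: "integrable M ?F" using integrable_mult_indicator[OF AM f] by simp
  have "(\<integral>x\<in>A. avg p f x \<partial>M) = (\<integral>x. (\<Sum>g\<in>set_pmf p. pmf p g * translate g ?F x) \<partial>M)"
    unfolding set_lebesgue_integral_def
  proof (rule Bochner_Integration.integral_cong)
    fix x assume x: "x \<in> space M"
    have "indicator A (\<phi> (inv g) x) = (indicator A x :: real)" if "g \<in> set_pmf p" for g
      using inv[of "inv g" x] g[OF that] x by (simp add: indicator_def)
    then show "indicator A x *\<^sub>R avg p f x = (\<Sum>g\<in>set_pmf p. pmf p g * translate g ?F x)"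
      by (simp add: avg_def translate_def sum_distrib_left mult_ac)
  qed simp
  also have "\<dots> = (\<Sum>g\<in>set_pmf p. \<integral>x. pmf p g * translate g ?F x \<partial>M)"
    using translate_integrable[OF g F] by (intro Bochner_Integration.integral_sum) auto
  also have "\<dots> = (\<Sum>g\<in>set_pmf p. pmf p g * (\<integral>x. ?F x \<partial>M))"
    using integral_translate[OF g, of _ ?F] F by (intro sum.cong) auto
  also have "\<dots> = (\<integral>x. ?F x \<partial>M)"
    using p by (simp only: sum_distrib_right[symmetric]) (simp add: sum_pmf_eq_1 fin_supp_def)
  finally show ?thesis by (simp add: set_lebesgue_integral_def)
qed

text \<open>
  A function that is invariant almost everywhere under each group element separately is replaced
  by 0 off the set of points whose whole orbit sees a single value. Countability makes this set
  conull, and it is strictly invariant, as \<open>invariant_algebra\<close> requires.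
\<close>

lemma AE_invariant_version:
  fixes h :: "'x \<Rightarrow> real"
  assumes count: "countable (carrier G)" and h: "integrable M h"
    and inv: "\<And>g. g \<in> carrier G \<Longrightarrow> AE x in M. h (\<phi> g x) = h x"
  obtains h' where "h' \<in> borel_measurable (invariant_algebra G M \<phi>)" "AE x in M. h' x = h x"
proof
  define D where "D = {x \<in> space M. \<forall>g\<in>carrier G. h (\<phi> g x) = h x}"
  define h' where "h' = (\<lambda>x. if x \<in> D then h x else 0)"
  have hM [measurable]: "h \<in> borel_measurable M" using h by simp
  \<comment> \<open>\<open>D\<close> is a union of orbits, which makes \<open>h'\<close> strictly invariant.\<close>
  have D_inv: "\<phi> g x \<in> D \<longleftrightarrow> x \<in> D" if g: "g \<in> carrier G" and x: "x \<in> space M" for g x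
  proof -
    have 1: "\<phi> g y \<in> D" if g: "g \<in> carrier G" and "y \<in> D" for g y
    proof -
      have y: "y \<in> space M" "\<And>k. k \<in> carrier G \<Longrightarrow> h (\<phi> k y) = h y"
        using \<open>y \<in> D\<close> by (auto simp: D_def)
      have "h (\<phi> k (\<phi> g y)) = h (\<phi> g y)" if "k \<in> carrier G" for k
        using composition_rule[OF y(1) that g] y(2)[of "k \<otimes> g"] y(2)[of g] that g by simp
      then show ?thesis using y g by (auto simp: D_def act_closed)
    qed
    have "\<phi> g x \<in> D \<Longrightarrow> x \<in> D"
      using 1[of "inv g" "\<phi> g x"] g x by (simp add: act_inv_act)
    then show ?thesis using 1 g by blast
  qed
  have D_sets [measurable]: "D \<in> sets M"
  proof -
    have "{x \<in> space M. h (\<phi> g x) = h x} \<in> sets M" if "g \<in> carrier G" for g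
      using measurable_act[OF that] by measurable
    then have "{x \<in> space M. \<forall>g\<in>carrier G. h (\<phi> g x) = h x} \<in> sets M"
      using count by (intro sets.sets_Collect_countable_All') auto
    then show ?thesis by (simp add: D_def)
  qed
  show "h' \<in> borel_measurable (invariant_algebra G M \<phi>)"
  proof (rule measurableI)
    fix B :: "real set" assume B [measurable]: "B \<in> sets borel"
    have m: "h' \<in> borel_measurable M" unfolding h'_def by measurable
    have "h' (\<phi> g x) = h' x" if "g \<in> carrier G" "x \<in> space M" for g x
      using D_inv[OF that] that by (auto simp: h'_def D_def)
    then show "h' -` B \<inter> space (invariant_algebra G M \<phi>) \<in> sets (invariant_algebra G M \<phi>)"
      using measurable_sets[OF m B] act_closed
      by (auto simp: space_invariant_algebra sets_invariant_algebra)
  qed simp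
  have "AE x in M. \<forall>g\<in>carrier G. h (\<phi> g x) = h x"
    using count inv by (simp add: AE_ball_countable)
  then show "AE x in M. h' x = h x"
    by (rule AE_mp) (auto intro!: AE_I2 simp: h'_def D_def)
qed

lemma set_integral_diff_le_L1:
  fixes u v :: "'x \<Rightarrow> real"
  assumes "integrable M u" "integrable M v" "A \<in> sets M"
  shows "\<bar>(\<integral>x\<in>A. u x \<partial>M) - (\<integral>x\<in>A. v x \<partial>M)\<bar> \<le> (\<integral>x. \<bar>u x - v x\<bar> \<partial>M)"
proof -
  have i: "integrable M (\<lambda>x. indicator A x * u x)" "integrable M (\<lambda>x. indicator A x * v x)"
    using integrable_mult_indicator[OF assms(3,1)] integrable_mult_indicator[OF assms(3,2)] by auto
  have "(\<integral>x\<in>A. u x \<partial>M) - (\<integral>x\<in>A. v x \<partial>M) = (\<integral>x. indicator A x * u x - indicator A x * v x \<partial>M)"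
    using i by (simp add: set_lebesgue_integral_def)
  also have "\<bar>\<dots>\<bar> \<le> (\<integral>x. \<bar>indicator A x * u x - indicator A x * v x\<bar> \<partial>M)"
    by (rule integral_abs_bound)
  also have "\<dots> \<le> (\<integral>x. \<bar>u x - v x\<bar> \<partial>M)"
    using assms i by (intro integral_mono) (auto simp: indicator_def)
  finally show ?thesis .
qed

text \<open>
  An average of \<open>f\<close> has the same integral as \<open>f\<close> over each invariant set, and this passes to
  \<open>L\<^sup>1\<close> limits; together with invariance it characterises the conditional expectation. So it is
  enough to find some invariant limit.
\<close>

lemma invariant_limit_is_inv_exp:
  assumes count: "countable (carrier G)" and f: "integrable M f" and h: "integrable M h"
    and p: "\<And>n. fin_supp (p n)"
    and inv: "\<And>g. g \<in> carrier G \<Longrightarrow> AE x in M. h (\<phi> g x) = h x"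
    and lim: "(\<lambda>n. \<integral>x. \<bar>avg (p n) f x - h x\<bar> \<partial>M) \<longlonglongrightarrow> 0"
  shows "(\<lambda>n. \<integral>x. \<bar>avg (p n) f x - inv_exp f x\<bar> \<partial>M) \<longlonglongrightarrow> 0"
proof -
  obtain h' where h': "h' \<in> borel_measurable (invariant_algebra G M \<phi>)"
    and hh': "AE x in M. h' x = h x"
    using AE_invariant_version[OF count h inv] by blast
  have h'M [measurable]: "h' \<in> borel_measurable M"
    using h' by (rule measurable_from_subalg[OF subalgebra_invariant_algebra])
  have h'i: "integrable M h'"
    using hh' h by (subst integrable_cong_AE[of _ _ h]) auto
  have ae: "AE x in M. inv_exp f x = h' x"
  proof (rule I.real_cond_exp_charact[OF _ f h'i h'])
    fix A assume A: "A \<in> sets (invariant_algebra G M \<phi>)"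
    then have AM [measurable]: "A \<in> sets M" by (simp add: sets_invariant_algebra)
    have "\<bar>(\<integral>x\<in>A. f x \<partial>M) - (\<integral>x\<in>A. h x \<partial>M)\<bar> \<le> (\<integral>x. \<bar>avg (p n) f x - h x\<bar> \<partial>M)" for n
      using set_integral_diff_le_L1[OF avg_integrable[OF p f] h AM] set_integral_avg[OF p f A]
      by simp
    then have "\<bar>(\<integral>x\<in>A. f x \<partial>M) - (\<integral>x\<in>A. h x \<partial>M)\<bar> \<le> 0"
      by (intro LIMSEQ_le_const[OF lim]) auto
    moreover have "(\<integral>x\<in>A. h x \<partial>M) = (\<integral>x\<in>A. h' x \<partial>M)"
      unfolding set_lebesgue_integral_def using hh' h by (intro integral_cong_AE) auto
    ultimately show "(\<integral>x\<in>A. f x \<partial>M) = (\<integral>x\<in>A. h' x \<partial>M)" by simp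
  qed
  have "(\<integral>x. \<bar>avg (p n) f x - inv_exp f x\<bar> \<partial>M) = (\<integral>x. \<bar>avg (p n) f x - h x\<bar> \<partial>M)" for n
    using ae hh' avg_integrable[OF p f] I.real_cond_exp_int(1)[OF f] h
    by (intro integral_cong_AE) auto
  then show ?thesis using lim by simp
qed

section \<open>Square distance and variance\<close>

text \<open>
  Bounded measurable functions serve as a dense subspace of \<open>L\<^sup>2\<close> on which every integral in
  sight exists, and which pointwise averaging preserves together with the bound.
\<close>

definition bdd_meas :: "('x \<Rightarrow> real) \<Rightarrow> bool" where
  "bdd_meas f \<longleftrightarrow> f \<in> borel_measurable M \<and> (\<exists>C. \<forall>x\<in>space M. \<bar>f x\<bar> \<le> C)"

lemma bdd_measurable [measurable_dest]: "bdd_meas f \<Longrightarrow> f \<in> borel_measurable M"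
  by (simp add: bdd_meas_def)

lemma bdd_integrable: "bdd_meas f \<Longrightarrow> integrable M f"
  unfolding bdd_meas_def by (metis (no_types, lifting) AE_I2 integrable_const_bound real_norm_def)

lemma bdd_mult: assumes "bdd_meas f" "bdd_meas h" shows "bdd_meas (\<lambda>x. f x * h x)"
proof -
  obtain C D where CD: "\<And>x. x \<in> space M \<Longrightarrow> \<bar>f x\<bar> \<le> C" "\<And>x. x \<in> space M \<Longrightarrow> \<bar>h x\<bar> \<le> D"
    using assms unfolding bdd_meas_def by blast
  have "\<bar>f x * h x\<bar> \<le> C * D" if "x \<in> space M" for x
    using mult_mono[OF CD(1)[OF that] CD(2)[OF that]] CD(1)[OF that] by (simp add: abs_mult)
  then show ?thesis using assms unfolding bdd_meas_def by auto
qed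

lemma bdd_diff: assumes "bdd_meas f" "bdd_meas h" shows "bdd_meas (\<lambda>x. f x - h x)"
proof -
  obtain C D where CD: "\<And>x. x \<in> space M \<Longrightarrow> \<bar>f x\<bar> \<le> C" "\<And>x. x \<in> space M \<Longrightarrow> \<bar>h x\<bar> \<le> D"
    using assms unfolding bdd_meas_def by blast
  have "\<bar>f x - h x\<bar> \<le> C + D" if "x \<in> space M" for x
    using CD(1)[OF that] CD(2)[OF that] by simp
  then show ?thesis using assms unfolding bdd_meas_def by auto
qed

lemma bdd_power2: "bdd_meas f \<Longrightarrow> bdd_meas (\<lambda>x. (f x)\<^sup>2)"
  using bdd_mult[of f f] by (simp add: power2_eq_square)

lemma bdd_translate: "g \<in> carrier G \<Longrightarrow> bdd_meas f \<Longrightarrow> bdd_meas (translate g f)"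
  unfolding bdd_meas_def using act_closed[of "inv g"] translate_measurable[of g f]
  by (auto simp: translate_def)

lemma avg_bound:
  assumes p: "fin_supp p" and C: "\<And>x. x \<in> space M \<Longrightarrow> \<bar>f x\<bar> \<le> C" and x: "x \<in> space M"
  shows "\<bar>avg p f x\<bar> \<le> C"
proof -
  have "\<bar>avg p f x\<bar> \<le> (\<Sum>g\<in>set_pmf p. pmf p g * \<bar>translate g f x\<bar>)"
    unfolding avg_def by (rule order_trans[OF sum_abs]) (simp add: abs_mult)
  also have "\<dots> \<le> (\<Sum>g\<in>set_pmf p. pmf p g * C)"
    using p x act_closed by (intro sum_mono mult_left_mono) (auto simp: translate_def fin_supp_def intro!: C)
  also have "\<dots> = C"
    using p by (simp add: sum_distrib_right[symmetric] sum_pmf_eq_1 fin_supp_def)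
  finally show ?thesis .
qed

lemma bdd_avg: "fin_supp p \<Longrightarrow> bdd_meas f \<Longrightarrow> bdd_meas (avg p f)"
  unfolding bdd_meas_def using avg_bound[of p f] avg_measurable[of p f] by blast

text \<open>
  The squared \<open>L\<^sup>2\<close> distance. Leaving out the square root keeps the estimates polynomial, at the
  price of a factor 2 in the triangle inequality.
\<close>

definition sqd :: "('x \<Rightarrow> real) \<Rightarrow> ('x \<Rightarrow> real) \<Rightarrow> real" where
  "sqd f h = (\<integral>x. (f x - h x)\<^sup>2 \<partial>M)"

lemma sqd_nonneg: "0 \<le> sqd f h"
  by (simp add: sqd_def)

lemma sqd_commute: "sqd f h = sqd h f"
  by (simp add: sqd_def power2_commute)

lemma sqd_triangle:
  assumes "bdd_meas f" "bdd_meas g" "bdd_meas h"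
  shows "sqd f h \<le> 2 * sqd f g + 2 * sqd g h"
proof -
  have i: "integrable M (\<lambda>x. (f x - h x)\<^sup>2)" "integrable M (\<lambda>x. (f x - g x)\<^sup>2)"
    "integrable M (\<lambda>x. (g x - h x)\<^sup>2)"
    using assms by (auto intro!: bdd_integrable bdd_power2 bdd_diff)
  have "sqd f h \<le> (\<integral>x. 2 * (f x - g x)\<^sup>2 + 2 * (g x - h x)\<^sup>2 \<partial>M)"
    unfolding sqd_def
  proof (rule integral_mono)
    show "(f x - h x)\<^sup>2 \<le> 2 * (f x - g x)\<^sup>2 + 2 * (g x - h x)\<^sup>2" for x
      using zero_le_power2[of "(f x - g x) - (g x - h x)"]
      by (simp add: power2_eq_square algebra_simps)
  qed (use i in auto)
  also have "\<dots> = 2 * sqd f g + 2 * sqd g h"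
    using i by (simp add: sqd_def)
  finally show ?thesis .
qed

lemma sqd_translate:
  assumes "g \<in> carrier G" "bdd_meas f" "bdd_meas h"
  shows "sqd (translate g f) (translate g h) = sqd f h"
  using integral_translate[OF assms(1), of "\<lambda>x. (f x - h x)\<^sup>2"]
    bdd_power2[OF bdd_diff[OF assms(2,3)]]
  by (simp add: sqd_def translate_def bdd_meas_def)

lemma sqd_cong:
  "(\<And>x. x \<in> space M \<Longrightarrow> f x = f' x) \<Longrightarrow> (\<And>x. x \<in> space M \<Longrightarrow> h x = h' x) \<Longrightarrow> sqd f h = sqd f' h'"
  unfolding sqd_def by (intro Bochner_Integration.integral_cong) auto

lemma sqd_translate_mult:
  "g \<in> carrier G \<Longrightarrow> k \<in> carrier G \<Longrightarrow>
    sqd (translate g (translate k f)) h = sqd (translate (g \<otimes> k) f) h"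
  by (intro sqd_cong) (auto simp: translate_mult)

lemma translate_one: "x \<in> space M \<Longrightarrow> translate \<one> f x = f x"
  by (simp add: translate_def act_one)

lemma sqd_translate_inv:
  assumes "g \<in> carrier G" "bdd_meas f" "bdd_meas h"
  shows "sqd (translate (inv g) f) h = sqd f (translate g h)"
proof -
  have "sqd (translate (inv g) f) h = sqd (translate g (translate (inv g) f)) (translate g h)"
    using assms by (simp add: sqd_translate bdd_translate)
  also have "\<dots> = sqd f (translate g h)"
    using assms by (intro sqd_cong) (auto simp: translate_mult translate_one)
  finally show ?thesis .
qed

lemma sqd_expand:
  assumes "bdd_meas f" "bdd_meas h"
  shows "sqd f h = (\<integral>x. (f x)\<^sup>2 \<partial>M) + (\<integral>x. (h x)\<^sup>2 \<partial>M) - 2 * (\<integral>x. f x * h x \<partial>M)"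
proof -
  have i: "integrable M (\<lambda>x. (f x)\<^sup>2)" "integrable M (\<lambda>x. (h x)\<^sup>2)" "integrable M (\<lambda>x. f x * h x)"
    using assms by (auto intro!: bdd_integrable bdd_power2 bdd_mult)
  have "sqd f h = (\<integral>x. (f x)\<^sup>2 + (h x)\<^sup>2 - 2 * (f x * h x) \<partial>M)"
    unfolding sqd_def by (simp add: power2_diff mult.assoc)
  then show ?thesis using i by simp
qed

lemma L1_le_sqrt_sqd:
  assumes "bdd_meas f" "bdd_meas h"
  shows "(\<integral>x. \<bar>f x - h x\<bar> \<partial>M) \<le> sqrt (sqd f h)"
proof (rule real_le_rsqrt)
  let ?X = "\<lambda>x. \<bar>f x - h x\<bar>"
  have "integrable M ?X" "integrable M (\<lambda>x. (?X x)\<^sup>2)"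
    using assms by (auto intro!: bdd_integrable bdd_power2 bdd_diff integrable_abs)
  then have "variance ?X = expectation (\<lambda>x. (?X x)\<^sup>2) - (expectation ?X)\<^sup>2"
    by (rule variance_eq)
  then show "(expectation ?X)\<^sup>2 \<le> sqd f h"
    using variance_positive[of ?X] by (simp add: sqd_def)
qed

text \<open>
  This is the identity \<open>\<Sum> p g (t g - m)\<^sup>2 = \<Sum> p g (t g)\<^sup>2 - m\<^sup>2\<close> for the mean \<open>m\<close> of the numbers
  \<open>t g\<close>, applied at each point and integrated; the translates of \<open>f\<close> all have the same norm. It is
  a quantitative form of strict convexity: if averaging hardly shortens \<open>f\<close>, then all translates
  of \<open>f\<close> are close to their average.
\<close>

lemma variance_identity:
  assumes p: "fin_supp p" and f: "bdd_meas f"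
  shows "(\<Sum>g\<in>set_pmf p. pmf p g * sqd (translate g f) (avg p f)) =
    (\<integral>x. (f x)\<^sup>2 \<partial>M) - (\<integral>x. (avg p f x)\<^sup>2 \<partial>M)"
proof -
  have g: "g \<in> carrier G" if "g \<in> set_pmf p" for g using that p by (auto simp: fin_supp_def)
  have s1: "(\<Sum>g\<in>set_pmf p. pmf p g) = 1" using p by (simp add: sum_pmf_eq_1 fin_supp_def)
  note A = bdd_avg[OF p f]
  have "(\<Sum>g\<in>set_pmf p. pmf p g * sqd (translate g f) (avg p f)) =
    (\<integral>x. (\<Sum>g\<in>set_pmf p. pmf p g * (translate g f x - avg p f x)\<^sup>2) \<partial>M)"
    unfolding sqd_def using f A g
    by (subst Bochner_Integration.integral_sum)
      (auto intro!: bdd_integrable bdd_power2 bdd_diff bdd_translate)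
  also have "\<dots> = (\<integral>x. (\<Sum>g\<in>set_pmf p. pmf p g * (translate g f x)\<^sup>2) - (avg p f x)\<^sup>2 \<partial>M)"
  proof (rule Bochner_Integration.integral_cong)
    fix x
    have "(\<Sum>g\<in>set_pmf p. pmf p g * (translate g f x - avg p f x)\<^sup>2) =
      (\<Sum>g\<in>set_pmf p. pmf p g * (translate g f x)\<^sup>2 + (avg p f x)\<^sup>2 * pmf p g
         - 2 * avg p f x * (pmf p g * translate g f x))"
      by (intro sum.cong) (auto simp: power2_eq_square algebra_simps)
    also have "\<dots> = (\<Sum>g\<in>set_pmf p. pmf p g * (translate g f x)\<^sup>2) + (avg p f x)\<^sup>2
        - 2 * avg p f x * avg p f x"
      by (simp only: sum.distrib sum_subtractf sum_distrib_left[symmetric] s1 mult_1_right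
          avg_def[symmetric])
    finally show "(\<Sum>g\<in>set_pmf p. pmf p g * (translate g f x - avg p f x)\<^sup>2) =
      (\<Sum>g\<in>set_pmf p. pmf p g * (translate g f x)\<^sup>2) - (avg p f x)\<^sup>2"
      by (simp add: power2_eq_square)
  qed simp
  also have "\<dots> = (\<integral>x. (\<Sum>g\<in>set_pmf p. pmf p g * (translate g f x)\<^sup>2) \<partial>M)
      - (\<integral>x. (avg p f x)\<^sup>2 \<partial>M)"
    using f A g
    by (subst Bochner_Integration.integral_diff)
      (auto intro!: bdd_integrable bdd_power2 bdd_translate Bochner_Integration.integrable_sum
        integrable_mult_right)
  also have "(\<integral>x. (\<Sum>g\<in>set_pmf p. pmf p g * (translate g f x)\<^sup>2) \<partial>M) =
      (\<Sum>g\<in>set_pmf p. pmf p g * (\<integral>x. (translate g f x)\<^sup>2 \<partial>M))"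
    using f g
    by (subst Bochner_Integration.integral_sum)
      (auto intro!: bdd_integrable bdd_power2 bdd_translate)
  also have "\<dots> =
      (\<Sum>g\<in>set_pmf p. pmf p g * (\<integral>x. (f x)\<^sup>2 \<partial>M))"
  proof (rule sum.cong)
    fix h assume "h \<in> set_pmf p"
    then show "pmf p h * (\<integral>x. (translate h f x)\<^sup>2 \<partial>M) = pmf p h * (\<integral>x. (f x)\<^sup>2 \<partial>M)"
      using integral_translate[OF g, of h "\<lambda>x. (f x)\<^sup>2"] f by (simp add: translate_def bdd_meas_def)
  qed simp
  also have "\<dots> = (\<integral>x. (f x)\<^sup>2 \<partial>M)" by (simp add: sum_distrib_right[symmetric] s1)
  finally show ?thesis .
qed

lemma sqd_translate_avg_le:
  assumes p: "fin_supp p" and f: "bdd_meas f" and g: "g \<in> set_pmf p"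
  shows "sqd (translate g f) (avg p f) \<le>
    ((\<integral>x. (f x)\<^sup>2 \<partial>M) - (\<integral>x. (avg p f x)\<^sup>2 \<partial>M)) / pmf p g"
proof -
  have "pmf p g * sqd (translate g f) (avg p f) \<le>
      (\<Sum>g\<in>set_pmf p. pmf p g * sqd (translate g f) (avg p f))"
    using p g by (intro member_le_sum) (auto simp: fin_supp_def sqd_nonneg)
  then show ?thesis
    unfolding variance_identity[OF p f] using g
    by (simp add: pmf_positive pos_le_divide_eq mult.commute)
qed

lemma L2_avg_le:
  assumes "fin_supp p" "bdd_meas f"
  shows "(\<integral>x. (avg p f x)\<^sup>2 \<partial>M) \<le> (\<integral>x. (f x)\<^sup>2 \<partial>M)"
proof -
  have "0 \<le> (\<Sum>g\<in>set_pmf p. pmf p g * sqd (translate g f) (avg p f))"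
    by (intro sum_nonneg mult_nonneg_nonneg sqd_nonneg) auto
  then show ?thesis by (simp add: variance_identity[OF assms])
qed

definition symmetric :: "'a pmf \<Rightarrow> bool" where
  "symmetric p \<longleftrightarrow> (\<forall>g\<in>carrier G. pmf p (inv g) = pmf p g)"

text \<open>
  The adjoint of the translation by \<open>g\<close> is the translation by its inverse, and symmetry gives both
  the same weight.
\<close>

lemma avg_self_adjoint:
  assumes p: "fin_supp p" "symmetric p" and f: "bdd_meas f" and h: "bdd_meas h"
  shows "(\<integral>x. avg p f x * h x \<partial>M) = (\<integral>x. f x * avg p h x \<partial>M)"
proof -
  have g: "g \<in> carrier G" if "g \<in> set_pmf p" for g using that p by (auto simp: fin_supp_def)
  have sym: "inv g \<in> set_pmf p" "pmf p (inv g) = pmf p g" if "g \<in> set_pmf p" for g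
    using g[OF that] p(2) that by (auto simp: symmetric_def set_pmf_iff)
  have tr: "(\<integral>x. translate g f x * h x \<partial>M) = (\<integral>x. f x * translate (inv g) h x \<partial>M)"
    if "g \<in> carrier G" for g
  proof -
    have "(\<integral>x. translate g f x * h x \<partial>M) =
        (\<integral>x. translate g (\<lambda>x. f x * translate (inv g) h x) x \<partial>M)"
      using that by (intro Bochner_Integration.integral_cong)
        (auto simp: translate_def act_act_inv)
    also have "\<dots> = (\<integral>x. f x * translate (inv g) h x \<partial>M)"
      using that f h by (intro integral_translate bdd_measurable bdd_mult bdd_translate) auto
    finally show ?thesis .
  qed
  have "(\<integral>x. avg p f x * h x \<partial>M) = (\<Sum>g\<in>set_pmf p. pmf p g * (\<integral>x. translate g f x * h x \<partial>M))"
    unfolding avg_def sum_distrib_right mult.assoc using f h g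
    by (subst Bochner_Integration.integral_sum)
      (auto intro!: bdd_integrable bdd_mult bdd_translate)
  also have "\<dots> = (\<Sum>g\<in>set_pmf p. pmf p g * (\<integral>x. f x * translate (inv g) h x \<partial>M))"
    using tr g by simp
  also have "\<dots> = (\<Sum>g\<in>set_pmf p. pmf p g * (\<integral>x. f x * translate g h x \<partial>M))"
    by (rule sum.reindex_bij_witness[of _ "\<lambda>g. inv g" "\<lambda>g. inv g"]) (auto simp: sym g)
  also have "\<dots> = (\<integral>x. f x * avg p h x \<partial>M)"
    unfolding avg_def sum_distrib_left mult.left_commute[of "f _"] using f h g
    by (subst Bochner_Integration.integral_sum)
      (auto intro!: bdd_integrable bdd_mult bdd_translate)
  finally show ?thesis .
qed

end

section \<open>Alternating products of two symmetric averages\<close>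

lemma squeeze_to_0:
  fixes u :: "nat \<Rightarrow> real"
  assumes "v \<longlonglongrightarrow> 0" "\<And>k. 0 \<le> u k" "\<And>k. u k \<le> v k"
  shows "u \<longlonglongrightarrow> 0"
  using assms by (intro tendsto_sandwich[of "\<lambda>_. 0" u _ v]) auto

text \<open>
  Two steps from the same support lead almost back to the starting vector, whatever the two
  elements are; the group collects what follows from this.
\<close>

definition return_group :: "('g, 'b) monoid_scheme \<Rightarrow> 'g pmf \<Rightarrow> 'g pmf \<Rightarrow> 'g set" where
  "return_group G p q = generate G
    ({g \<otimes>\<^bsub>G\<^esub> h |g h. g \<in> set_pmf p \<and> h \<in> set_pmf p} \<union>
     {g \<otimes>\<^bsub>G\<^esub> h |g h. g \<in> set_pmf q \<and> h \<in> set_pmf q})"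

locale alternating_averages = pmp_system G M \<phi>
  for G (structure) and M :: "'x measure" and \<phi> +
  fixes p q :: "'a pmf"
  assumes fin: "fin_supp p" "fin_supp q" and sym: "symmetric p" "symmetric q"
begin

definition alt :: "nat \<Rightarrow> 'a pmf" where
  "alt k = (if even k then p else q)"

primrec iter :: "('x \<Rightarrow> real) \<Rightarrow> nat \<Rightarrow> 'x \<Rightarrow> real" where
  "iter f 0 = f"
| "iter f (Suc k) = avg (alt k) (iter f k)"

lemma alt_fin: "fin_supp (alt k)" and alt_sym: "symmetric (alt k)"
  using fin sym by (auto simp: alt_def)

lemma alt_carrier: "g \<in> set_pmf (alt k) \<Longrightarrow> g \<in> carrier G"
  using alt_fin[of k] by (auto simp: fin_supp_def)

lemma bdd_iter: "bdd_meas f \<Longrightarrow> bdd_meas (iter f k)"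
  by (induction k) (auto intro: bdd_avg alt_fin)

lemma iter_bound:
  assumes "\<And>x. x \<in> space M \<Longrightarrow> \<bar>f x\<bar> \<le> C" "x \<in> space M"
  shows "\<bar>iter f k x\<bar> \<le> C"
  using assms(2) by (induction k arbitrary: x) (auto intro!: assms(1) avg_bound alt_fin)

text \<open>
  One averaging operator is moved across the inner product. This needs the operators at \<open>m\<close> and
  \<open>n\<close> to coincide, that is, an odd difference of the two indices on either side.
\<close>

lemma iter_inner_step:
  assumes "bdd_meas f" "even m \<longleftrightarrow> even n"
  shows "(\<integral>x. iter f (Suc m) x * iter f n x \<partial>M) = (\<integral>x. iter f m x * iter f (Suc n) x \<partial>M)"
proof -
  have "alt m = alt n" using assms(2) by (simp add: alt_def)
  then show ?thesis
    using avg_self_adjoint[OF alt_fin alt_sym bdd_iter[OF assms(1)] bdd_iter[OF assms(1)], of m m n]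
    by simp
qed

lemma iter_inner:
  assumes "bdd_meas f" "d \<le> k"
  shows "(\<integral>x. iter f (Suc k + d) x * iter f (k - d) x \<partial>M) =
    (\<integral>x. iter f (Suc k) x * iter f k x \<partial>M)"
  using assms(2)
proof (induction d)
  case (Suc d)
  have "(\<integral>x. iter f (Suc (Suc k + d)) x * iter f (k - Suc d) x \<partial>M) =
      (\<integral>x. iter f (Suc k + d) x * iter f (Suc (k - Suc d)) x \<partial>M)"
    using Suc.prems by (intro iter_inner_step assms(1)) presburger
  then show ?case using Suc by (simp add: Suc_diff_Suc del: iter.simps)
qed simp

definition energy :: "('x \<Rightarrow> real) \<Rightarrow> nat \<Rightarrow> real" where
  "energy f k = (\<integral>x. (iter f k x)\<^sup>2 \<partial>M)"

lemma energy_Suc_le: "bdd_meas f \<Longrightarrow> energy f (Suc k) \<le> energy f k"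
  by (simp add: energy_def L2_avg_le alt_fin bdd_iter)

lemma energy_convergent:
  assumes "bdd_meas f"
  obtains L where "energy f \<longlonglongrightarrow> L"
proof -
  have "decseq (energy f)" using energy_Suc_le[OF assms] by (rule decseq_SucI)
  moreover have "0 \<le> energy f k" for k by (simp add: energy_def)
  ultimately show ?thesis using decseq_convergent[of "energy f" 0] that by blast
qed

text \<open>
  The drops of the energy are the variances of the steps, and those of a decreasing nonnegative
  sequence tend to 0.
\<close>

lemma energy_drop_tendsto:
  assumes "bdd_meas f"
  shows "(\<lambda>k. energy f k - energy f (Suc k)) \<longlonglongrightarrow> 0"
proof -
  obtain L where L: "energy f \<longlonglongrightarrow> L" using energy_convergent[OF assms] .
  show ?thesis using tendsto_diff[OF L LIMSEQ_Suc[OF L]] by simp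
qed

lemma sqd_step_le:
  assumes "bdd_meas f" "g \<in> set_pmf (alt k)"
  shows "sqd (translate g (iter f k)) (iter f (Suc k)) \<le>
    (energy f k - energy f (Suc k)) / pmf (alt k) g"
  using sqd_translate_avg_le[OF alt_fin bdd_iter[OF assms(1)] assms(2)]
  by (simp add: energy_def)

text \<open>
  Since \<open>g\<close> is an isometry, moving the new vector by \<open>g\<close> costs as much as moving the old one by
  the inverse of \<open>g\<close>, which has the same weight.
\<close>

lemma sqd_step_back_le:
  assumes f: "bdd_meas f" and g: "g \<in> set_pmf (alt k)"
  shows "sqd (translate g (iter f (Suc k))) (iter f k) \<le>
    (energy f k - energy f (Suc k)) / pmf (alt k) g"
proof -
  have gc: "g \<in> carrier G" using alt_carrier[OF g] .
  have i: "pmf (alt k) (inv g) = pmf (alt k) g" using alt_sym gc by (simp add: symmetric_def)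
  then have "inv g \<in> set_pmf (alt k)" using g by (simp add: set_pmf_iff)
  from sqd_step_le[OF f this]
  have "sqd (translate (inv g) (iter f k)) (iter f (Suc k)) \<le>
      (energy f k - energy f (Suc k)) / pmf (alt k) g" by (simp only: i)
  then show ?thesis
    by (simp only: sqd_translate_inv[OF gc bdd_iter[OF f] bdd_iter[OF f]] sqd_commute[of "iter f k"])
qed

definition asymp_stab :: "('x \<Rightarrow> real) \<Rightarrow> 'a set" where
  "asymp_stab f =
    {g \<in> carrier G. (\<lambda>k. sqd (translate g (iter f k)) (iter f k)) \<longlonglongrightarrow> 0}"

lemma asymp_stab_one: "bdd_meas f \<Longrightarrow> \<one> \<in> asymp_stab f"
proof -
  have "sqd (translate \<one> h) h = sqd h h" for h by (intro sqd_cong) (auto simp: translate_one)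
  then show ?thesis by (simp add: asymp_stab_def sqd_def)
qed

lemma asymp_stab_inv: "bdd_meas f \<Longrightarrow> g \<in> asymp_stab f \<Longrightarrow> inv g \<in> asymp_stab f"
  by (simp add: asymp_stab_def sqd_translate_inv bdd_iter sqd_commute[of "iter f _"])

lemma asymp_stab_mult:
  assumes f: "bdd_meas f" and g: "g \<in> asymp_stab f" and h: "h \<in> asymp_stab f"
  shows "g \<otimes> h \<in> asymp_stab f"
proof -
  have c: "g \<in> carrier G" "h \<in> carrier G" using g h by (auto simp: asymp_stab_def)
  let ?s = "\<lambda>g k. sqd (translate g (iter f k)) (iter f k)"
  have le: "?s (g \<otimes> h) k \<le> 2 * ?s h k + 2 * ?s g k" for k
  proof -
    have "?s (g \<otimes> h) k = sqd (translate g (translate h (iter f k))) (iter f k)"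
      using c by (simp add: sqd_translate_mult)
    also have "\<dots> \<le> 2 * sqd (translate g (translate h (iter f k))) (translate g (iter f k)) + 2 * ?s g k"
      using c f by (intro sqd_triangle bdd_translate bdd_iter)
    finally show ?thesis using c f by (simp add: sqd_translate bdd_translate bdd_iter)
  qed
  have "(\<lambda>k. 2 * ?s h k + 2 * ?s g k) \<longlonglongrightarrow> 2 * 0 + 2 * 0"
    using g h by (intro tendsto_add tendsto_mult_left) (auto simp: asymp_stab_def)
  then have "?s (g \<otimes> h) \<longlonglongrightarrow> 0"
    using le by (intro squeeze_to_0[of _ "?s (g \<otimes> h)"]) (auto simp: sqd_nonneg)
  then show ?thesis using c by (simp add: asymp_stab_def)
qed

text \<open>
  The steps alternate, so at each time one of the two neighbouring steps, the next or the
  previous one, uses the support containing \<open>g\<close> and \<open>h\<close>. The element \<open>h\<close> moves the current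
  vector along that step to the neighbour, and \<open>g\<close> moves it back.
\<close>

lemma asymp_stab_support:
  assumes f: "bdd_meas f" and g: "g \<in> set_pmf (alt i)" and h: "h \<in> set_pmf (alt i)"
  shows "g \<otimes> h \<in> asymp_stab f"
proof -
  have c: "g \<in> carrier G" "h \<in> carrier G" using alt_carrier g h by auto
  let ?s = "\<lambda>k. sqd (translate (g \<otimes> h) (iter f k)) (iter f k)"
  let ?D = "\<lambda>k. energy f k - energy f (Suc k)"
  define C where "C = 2 / pmf (alt i) g + 2 / pmf (alt i) h"
  have C: "0 \<le> C" by (simp add: C_def)
  have D: "0 \<le> ?D k" for k using energy_Suc_le[OF f] by simp
  have via: "?s k \<le> 2 * sqd (translate h (iter f k)) (iter f l) + 2 * sqd (translate g (iter f l)) (iter f k)" for k l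
  proof -
    have "?s k = sqd (translate g (translate h (iter f k))) (iter f k)"
      using c by (simp add: sqd_translate_mult)
    also have "\<dots> \<le> 2 * sqd (translate g (translate h (iter f k))) (translate g (iter f l))
        + 2 * sqd (translate g (iter f l)) (iter f k)"
      using c f by (intro sqd_triangle bdd_translate bdd_iter)
    finally show ?thesis using c f by (simp add: sqd_translate bdd_translate bdd_iter)
  qed
  have gen: "2 * (d / b) + 2 * (d / a) = (2 / a + 2 / b) * d" for a b d :: real
    by (simp add: distrib_right)
  have le: "?s (Suc k) \<le> C * ?D (Suc k) + C * ?D k" for k
  proof (cases "even k \<longleftrightarrow> even i")
    case True
    then have a: "alt k = alt i" by (simp add: alt_def)
    have "?s (Suc k) \<le> 2 * (?D k / pmf (alt i) h) + 2 * (?D k / pmf (alt i) g)"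
      using via[of "Suc k" k] sqd_step_back_le[OF f, of h k] sqd_step_le[OF f, of g k] g h unfolding a
      by linarith
    also have "\<dots> = C * ?D k" unfolding C_def by (rule gen)
    also have "\<dots> \<le> C * ?D (Suc k) + C * ?D k" using mult_nonneg_nonneg[OF C D[of "Suc k"]] by simp
    finally show ?thesis .
  next
    case False
    then have a: "alt (Suc k) = alt i" by (auto simp: alt_def)
    have "?s (Suc k) \<le> 2 * (?D (Suc k) / pmf (alt i) h) + 2 * (?D (Suc k) / pmf (alt i) g)"
      using via[of "Suc k" "Suc (Suc k)"] sqd_step_back_le[OF f, of g "Suc k"]
        sqd_step_le[OF f, of h "Suc k"] g h unfolding a
      by linarith
    also have "\<dots> = C * ?D (Suc k)" unfolding C_def by (rule gen)
    also have "\<dots> \<le> C * ?D (Suc k) + C * ?D k" using mult_nonneg_nonneg[OF C D[of k]] by simp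
    finally show ?thesis .
  qed
  have D0: "?D \<longlonglongrightarrow> 0" by (rule energy_drop_tendsto[OF f])
  have "(\<lambda>k. C * ?D (Suc k) + C * ?D k) \<longlonglongrightarrow> C * 0 + C * 0"
    using D0 LIMSEQ_Suc[OF D0] by (intro tendsto_add tendsto_mult_left)
  then have "(\<lambda>k. ?s (Suc k)) \<longlonglongrightarrow> 0"
    using le by (intro squeeze_to_0[of _ "\<lambda>k. ?s (Suc k)"]) (auto simp: sqd_nonneg)
  then have "?s \<longlonglongrightarrow> 0" by (rule LIMSEQ_imp_Suc)
  then show ?thesis using c by (simp add: asymp_stab_def)
qed

lemma return_group_subset:
  assumes f: "bdd_meas f"
  shows "return_group G p q \<subseteq> asymp_stab f"
proof
  fix g assume "g \<in> return_group G p q"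
  then show "g \<in> asymp_stab f"
    unfolding return_group_def
  proof (induction rule: generate.induct)
    case one
    show ?case by (rule asymp_stab_one[OF f])
  next
    case (incl h)
    then show ?case
      using asymp_stab_support[OF f, of _ 0] asymp_stab_support[OF f, of _ 1]
      by (auto simp: alt_def)
  next
    case (inv h)
    then show ?case
      using asymp_stab_support[OF f, of _ 0] asymp_stab_support[OF f, of _ 1]
      by (intro asymp_stab_inv f) (auto simp: alt_def)
  next
    case (eng h1 h2)
    then show ?case by (intro asymp_stab_mult f)
  qed
qed

context
  fixes f
  assumes f: "bdd_meas f" and meets: "set_pmf p \<inter> return_group G p q \<noteq> {}" "set_pmf q \<inter> return_group G p q \<noteq> {}"
begin

text \<open>
  If some element of each support asymptotically fixes the iterates, then a step, which nearly
  agrees with the action of that element, hardly moves them.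
\<close>

lemma iter_step_tendsto: "(\<lambda>k. sqd (iter f (Suc k)) (iter f k)) \<longlonglongrightarrow> 0"
proof -
  obtain g h where g: "g \<in> set_pmf p" "g \<in> asymp_stab f" and h: "h \<in> set_pmf q" "h \<in> asymp_stab f"
    using meets return_group_subset[OF f] by blast
  have c: "g \<in> carrier G" "h \<in> carrier G" using g h by (auto simp: asymp_stab_def)
  let ?s = "\<lambda>g k. sqd (translate g (iter f k)) (iter f k)"
  let ?D = "\<lambda>k. energy f k - energy f (Suc k)"
  let ?B = "\<lambda>k. 2 * (?D k / pmf p g) + 2 * (?D k / pmf q h) + 2 * ?s g k + 2 * ?s h k"
  have D: "0 \<le> ?D k" for k using energy_Suc_le[OF f] by simp
  have via: "sqd (iter f (Suc k)) (iter f k) \<le> 2 * (?D k / pmf (alt k) g) + 2 * ?s g k"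
    if "g \<in> set_pmf (alt k)" for g k
  proof -
    have "sqd (iter f (Suc k)) (iter f k) \<le>
        2 * sqd (iter f (Suc k)) (translate g (iter f k)) + 2 * ?s g k"
      using f alt_carrier[OF that] by (intro sqd_triangle bdd_translate bdd_iter)
    then show ?thesis
      using sqd_step_le[OF f that] unfolding sqd_commute[of "iter f (Suc k)" "translate _ _"]
      by linarith
  qed
  have le: "sqd (iter f (Suc k)) (iter f k) \<le> ?B k" for k
  proof (cases "even k")
    case True
    then have a: "alt k = p" by (simp add: alt_def)
    have "0 \<le> ?D k / pmf q h" using D by simp
    then show ?thesis
      using via[of g k, unfolded a] g(1) sqd_nonneg[of "translate h (iter f k)" "iter f k"]
      by linarith
  next
    case False
    then have a: "alt k = q" by (simp add: alt_def)
    have "0 \<le> ?D k / pmf p g" using D by simp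
    then show ?thesis
      using via[of h k, unfolded a] h(1) sqd_nonneg[of "translate g (iter f k)" "iter f k"]
      by linarith
  qed
  have "?B \<longlonglongrightarrow> 2 * (0 / pmf p g) + 2 * (0 / pmf q h) + 2 * 0 + 2 * 0"
    using g h by (intro tendsto_add tendsto_mult_left tendsto_divide energy_drop_tendsto f)
      (auto simp: asymp_stab_def set_pmf_iff)
  then have "?B \<longlonglongrightarrow> 0" by simp
  from this sqd_nonneg le show ?thesis by (rule squeeze_to_0)
qed

text \<open>
  For \<open>m + n = 2 k + 1\<close> the inner product of the iterates \<open>m\<close> and \<open>n\<close> is that of \<open>k + 1\<close> and \<open>k\<close>
  by \<open>iter_inner\<close>, and adjacent iterates are close. So the squared distance of the iterates \<open>m\<close>
  and \<open>n\<close> is a combination of energies in which the limit of the energy cancels. An even sum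
  \<open>m + n\<close> is reduced to odd ones by passing through \<open>m + 1\<close>.
\<close>

lemma iter_L2_Cauchy:
  assumes e: "0 < e"
  obtains K where "\<And>m n. K \<le> m \<Longrightarrow> K \<le> n \<Longrightarrow> sqd (iter f m) (iter f n) < e"
proof -
  obtain L where L: "energy f \<longlonglongrightarrow> L" using energy_convergent[OF f] .
  have "0 < e / 20" using e by simp
  then obtain K1 where K1: "\<And>k. K1 \<le> k \<Longrightarrow> \<bar>energy f k - L\<bar> < e / 20"
    using LIMSEQ_D[OF L, of "e / 20"] by auto
  obtain K2 where K2: "\<And>k. K2 \<le> k \<Longrightarrow> sqd (iter f (Suc k)) (iter f k) < e / 20"
    using LIMSEQ_D[OF iter_step_tendsto \<open>0 < e / 20\<close>] by (auto simp: sqd_nonneg)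
  \<comment> \<open>Four energies and one step enter below, each within \<open>e / 20\<close> of its limit, which
    makes \<open>e / 4\<close>; the factors 2 in the triangle inequality turn two such distances into \<open>e\<close>.\<close>
  define K where "K = max K1 K2"
  have gt: "sqd (iter f m) (iter f n) < e / 4" if mn: "K \<le> n" "n < m" "odd (m + n)" for m n
  proof -
    obtain k where k: "m + n = 2 * k + 1" using mn(3) by (rule oddE)
    define d where "d = k - n"
    have kd: "m = Suc k + d" "n = k - d" "d \<le> k" using k mn(2) unfolding d_def by linarith+
    have E: "sqd (iter f m) (iter f n) =
        energy f m + energy f n - 2 * (\<integral>x. iter f (Suc k) x * iter f k x \<partial>M)"
      using sqd_expand[OF bdd_iter[OF f] bdd_iter[OF f], of m n] iter_inner[OF f kd(3)] kd
      by (simp add: energy_def del: iter.simps)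
    have F: "sqd (iter f (Suc k)) (iter f k) =
        energy f (Suc k) + energy f k - 2 * (\<integral>x. iter f (Suc k) x * iter f k x \<partial>M)"
      using sqd_expand[OF bdd_iter[OF f] bdd_iter[OF f], of "Suc k" k]
      by (simp add: energy_def del: iter.simps)
    have "K \<le> k" using kd mn by simp
    then have "\<bar>energy f m - L\<bar> < e / 20" "\<bar>energy f n - L\<bar> < e / 20" "\<bar>energy f k - L\<bar> < e / 20"
      "\<bar>energy f (Suc k) - L\<bar> < e / 20" "sqd (iter f (Suc k)) (iter f k) < e / 20"
      using mn(1,2) by (intro K1 K2; simp add: K_def)+
    then show ?thesis using E F by linarith
  qed
  have odd: "sqd (iter f m) (iter f n) < e / 4" if "K \<le> m" "K \<le> n" "odd (m + n)" for m n
  proof (cases "n < m")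
    case False
    then have "m < n" using that by (cases "m = n") auto
    then show ?thesis using gt[of m n] that by (simp add: sqd_commute add.commute)
  qed (use gt that in auto)
  show thesis
  proof (rule that)
    fix m n assume mn: "K \<le> m" "K \<le> n"
    show "sqd (iter f m) (iter f n) < e"
    proof (cases "odd (m + n)")
      case True
      then show ?thesis using odd[OF mn] e by simp
    next
      case False
      have "sqd (iter f m) (iter f n) \<le>
          2 * sqd (iter f m) (iter f (Suc m)) + 2 * sqd (iter f (Suc m)) (iter f n)"
        using f by (intro sqd_triangle bdd_iter)
      moreover have "sqd (iter f m) (iter f (Suc m)) < e / 4" using mn by (intro odd) auto
      moreover have "sqd (iter f (Suc m)) (iter f n) < e / 4" using mn False by (intro odd) auto
      ultimately show ?thesis by simp
    qed
  qed
qed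

text \<open>
  Being Cauchy in \<open>L\<^sup>2\<close> the iterates are Cauchy in \<open>L\<^sup>1\<close>, so a subsequence converges almost
  everywhere. The common bound on the iterates makes dominated convergence applicable to it.
\<close>

proposition alternating_limit:
  obtains h where "integrable M h" "(\<lambda>k. \<integral>x. \<bar>iter f k x - h x\<bar> \<partial>M) \<longlonglongrightarrow> 0"
    "\<And>g. g \<in> return_group G p q \<Longrightarrow> AE x in M. translate g h x = h x"
proof -
  note wi = bdd_integrable[OF bdd_iter[OF f]]
  have wm [measurable]: "iter f k \<in> borel_measurable M" for k using bdd_iter[OF f] by (rule bdd_measurable)
  have C1: "\<exists>K. \<forall>m\<ge>K. \<forall>n\<ge>K. (\<integral>x. norm (iter f m x - iter f n x) \<partial>M) < e" if e: "0 < e" for e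
  proof -
    obtain K where K: "\<And>m n. K \<le> m \<Longrightarrow> K \<le> n \<Longrightarrow> sqd (iter f m) (iter f n) < e\<^sup>2"
      using iter_L2_Cauchy[of "e\<^sup>2"] e by auto
    have "(\<integral>x. norm (iter f m x - iter f n x) \<partial>M) < e" if "K \<le> m" "K \<le> n" for m n
      using L1_le_sqrt_sqd[OF bdd_iter[OF f] bdd_iter[OF f], of m n]
        real_sqrt_less_mono[OF K[OF that]] e by simp
    then show ?thesis by blast
  qed
  obtain r where r: "strict_mono r" "AE x in M. Cauchy (\<lambda>i. iter f (r i) x)"
    by (rule cauchy_L1_AE_cauchy_subseq[of M "iter f", OF wi C1])
  define h where "h x = lim (\<lambda>i. iter f (r i) x)" for x
  have hm [measurable]: "h \<in> borel_measurable M"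
    unfolding h_def by (rule borel_measurable_lim_metric) measurable
  obtain C where C: "\<And>x. x \<in> space M \<Longrightarrow> \<bar>f x\<bar> \<le> C" using f by (auto simp: bdd_meas_def)
  have ae: "AE x in M. (\<lambda>i. iter f (r i) x) \<longlonglongrightarrow> h x"
    using r(2) by eventually_elim (simp add: h_def Cauchy_convergent_iff convergent_LIMSEQ_iff)
  have hb: "AE x in M. \<bar>h x\<bar> \<le> C"
    using ae AE_space
  proof eventually_elim
    case (elim x)
    have "(\<lambda>i. \<bar>iter f (r i) x\<bar>) \<longlonglongrightarrow> \<bar>h x\<bar>" using elim by (intro tendsto_rabs)
    then show ?case using iter_bound[of f C x, OF C elim(2)] by (intro LIMSEQ_le_const2) auto
  qed
  have hi: "integrable M h" using hb by (intro integrable_const_bound[of _ C]) auto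
  have sub: "(\<lambda>i. \<integral>x. \<bar>iter f (r i) x - h x\<bar> \<partial>M) \<longlonglongrightarrow> (\<integral>x. 0 \<partial>M)"
  proof (rule integral_dominated_convergence[where w = "\<lambda>_. 2 * C"])
    show "AE x in M. (\<lambda>i. \<bar>iter f (r i) x - h x\<bar>) \<longlonglongrightarrow> 0"
      using ae by eventually_elim (simp add: LIM_zero tendsto_rabs_zero)
    show "AE x in M. norm \<bar>iter f (r i) x - h x\<bar> \<le> 2 * C" for i
      using hb AE_space
    proof eventually_elim
      case (elim x)
      show ?case using elim(1) iter_bound[of f C x "r i", OF C elim(2)] by simp
    qed
  qed auto
  have lim: "(\<lambda>k. \<integral>x. \<bar>iter f k x - h x\<bar> \<partial>M) \<longlonglongrightarrow> 0"
  proof (rule LIMSEQ_I)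
    fix e :: real assume "0 < e"
    then obtain K where K: "\<And>m n. K \<le> m \<Longrightarrow> K \<le> n \<Longrightarrow> (\<integral>x. \<bar>iter f m x - iter f n x\<bar> \<partial>M) < e / 2"
      using C1[of "e / 2"] by auto
    obtain I where I: "\<And>i. I \<le> i \<Longrightarrow> (\<integral>x. \<bar>iter f (r i) x - h x\<bar> \<partial>M) < e / 2"
      using LIMSEQ_D[OF sub, of "e / 2"] \<open>0 < e\<close> by auto
    define i where "i = max I K"
    have ri: "K \<le> r i" using strict_mono_imp_increasing[OF r(1), of i] by (simp add: i_def)
    have "norm ((\<integral>x. \<bar>iter f k x - h x\<bar> \<partial>M) - 0) < e" if "K \<le> k" for k
    proof -
      have "(\<integral>x. \<bar>iter f k x - h x\<bar> \<partial>M) \<le>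
          (\<integral>x. \<bar>iter f k x - iter f (r i) x\<bar> + \<bar>iter f (r i) x - h x\<bar> \<partial>M)"
        using wi hi by (intro integral_mono) auto
      also have "\<dots> = (\<integral>x. \<bar>iter f k x - iter f (r i) x\<bar> \<partial>M) + (\<integral>x. \<bar>iter f (r i) x - h x\<bar> \<partial>M)"
        using wi hi by (intro Bochner_Integration.integral_add) auto
      also have "\<dots> < e" using K[OF that ri] I[of i] by (simp add: i_def)
      finally show ?thesis by simp
    qed
    then show "\<exists>K. \<forall>k\<ge>K. norm ((\<integral>x. \<bar>iter f k x - h x\<bar> \<partial>M) - 0) < e" by blast
  qed
  have inv: "AE x in M. translate g h x = h x" if "g \<in> return_group G p q" for g
  proof -
    have g: "g \<in> carrier G" "(\<lambda>k. sqd (translate g (iter f k)) (iter f k)) \<longlonglongrightarrow> 0"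
      using that return_group_subset[OF f] by (auto simp: asymp_stab_def)
    note ti = translate_integrable[OF g(1)]
    let ?e = "\<lambda>k. \<integral>x. \<bar>iter f k x - h x\<bar> \<partial>M"
    have le: "(\<integral>x. \<bar>translate g h x - h x\<bar> \<partial>M) \<le>
        ?e k + sqrt (sqd (translate g (iter f k)) (iter f k)) + ?e k" for k
    proof -
      have "(\<integral>x. \<bar>translate g h x - h x\<bar> \<partial>M) \<le>
        (\<integral>x. \<bar>translate g (iter f k) x - translate g h x\<bar> +
          \<bar>translate g (iter f k) x - iter f k x\<bar> + \<bar>iter f k x - h x\<bar> \<partial>M)"
        using wi hi ti[OF wi] ti[OF hi] by (intro integral_mono) auto
      also have "\<dots> = (\<integral>x. \<bar>translate g (iter f k) x - translate g h x\<bar> \<partial>M) +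
          (\<integral>x. \<bar>translate g (iter f k) x - iter f k x\<bar> \<partial>M) + ?e k"
        using wi hi ti[OF wi] ti[OF hi] by simp
      also have "(\<integral>x. \<bar>translate g (iter f k) x - translate g h x\<bar> \<partial>M) = ?e k"
        by (rule L1_translate[OF g(1)]) auto
      finally show ?thesis
        using L1_le_sqrt_sqd[OF bdd_translate[OF g(1) bdd_iter[OF f]] bdd_iter[OF f], of k k] by simp
    qed
    have "(\<lambda>k. ?e k + sqrt (sqd (translate g (iter f k)) (iter f k)) + ?e k) \<longlonglongrightarrow> 0 + sqrt 0 + 0"
      using lim g(2) by (intro tendsto_add tendsto_real_sqrt)
    then have "(\<integral>x. \<bar>translate g h x - h x\<bar> \<partial>M) \<le> 0"
      using le by (intro LIMSEQ_le_const) auto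
    then have "(\<integral>x. \<bar>translate g h x - h x\<bar> \<partial>M) = 0"
      by (intro antisym integral_nonneg) auto
    then show ?thesis
      using hi ti[OF hi] by (subst (asm) integral_nonneg_eq_0_iff_AE) auto
  qed
  show thesis using hi lim inv by (rule that)
qed

end

end

section \<open>Averages over convolutions\<close>

definition conv_pmf :: "('g, 'b) monoid_scheme \<Rightarrow> 'g pmf \<Rightarrow> 'g pmf \<Rightarrow> 'g pmf" where
  "conv_pmf G p q = bind_pmf p (\<lambda>g. map_pmf (\<lambda>h. g \<otimes>\<^bsub>G\<^esub> h) q)"

primrec alt_walk :: "('g, 'b) monoid_scheme \<Rightarrow> 'g pmf \<Rightarrow> 'g pmf \<Rightarrow> nat \<Rightarrow> 'g pmf" where
  "alt_walk G p q 0 = return_pmf \<one>\<^bsub>G\<^esub>"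
| "alt_walk G p q (Suc k) = conv_pmf G (if even k then p else q) (alt_walk G p q k)"

lemma set_conv_pmf: "set_pmf (conv_pmf G p q) = {g \<otimes>\<^bsub>G\<^esub> h |g h. g \<in> set_pmf p \<and> h \<in> set_pmf q}"
  by (auto simp: conv_pmf_def)

context pmp_system
begin

lemma avg_eq_expectation:
  assumes "finite (set_pmf p)"
  shows "avg p f x = measure_pmf.expectation p (\<lambda>g. translate g f x)"
  unfolding avg_def using assms
  by (subst integral_measure_pmf_real[of "set_pmf p"]) (auto simp: mult.commute)

lemma fin_supp_conv:
  assumes "fin_supp p" "fin_supp q"
  shows "fin_supp (conv_pmf G p q)"
  using assms by (auto simp: fin_supp_def conv_pmf_def)

lemma fin_supp_return: "g \<in> carrier G \<Longrightarrow> fin_supp (return_pmf g)"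
  by (simp add: fin_supp_def)

lemma avg_return: "avg (return_pmf g) f x = translate g f x"
  by (simp add: avg_eq_expectation)

lemma avg_conv:
  assumes p: "fin_supp p" and q: "fin_supp q" and x: "x \<in> space M"
  shows "avg (conv_pmf G p q) f x = avg p (avg q f) x"
proof -
  have g: "g \<in> carrier G" if "g \<in> set_pmf p \<union> set_pmf q" for g
    using that p q by (auto simp: fin_supp_def)
  have "avg (conv_pmf G p q) f x = (\<Sum>g\<in>set_pmf p. pmf p g *\<^sub>R
      measure_pmf.expectation (map_pmf (\<lambda>h. g \<otimes> h) q) (\<lambda>k. translate k f x))"
  proof -
    have "finite (set_pmf (conv_pmf G p q))" using fin_supp_conv[OF p q] by (simp add: fin_supp_def)
    from avg_eq_expectation[OF this] show ?thesis
      using p q by (simp only: conv_pmf_def) (rule pmf_expectation_bind, auto simp: fin_supp_def)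
  qed
  also have "\<dots> = (\<Sum>g\<in>set_pmf p. pmf p g * translate g (avg q f) x)"
  proof (rule sum.cong)
    fix k assume k: "k \<in> set_pmf p"
    have "measure_pmf.expectation (map_pmf (\<lambda>h. k \<otimes> h) q) (\<lambda>g. translate g f x) =
        (\<Sum>h\<in>set_pmf q. translate (k \<otimes> h) f x * pmf q h)"
      using q by (simp add: integral_map_pmf) (rule integral_measure_pmf_real, auto simp: fin_supp_def)
    also have "\<dots> = (\<Sum>h\<in>set_pmf q. pmf q h * translate k (translate h f) x)"
      using k g x by (intro sum.cong) (auto simp: translate_mult)
    also have "\<dots> = translate k (avg q f) x"
      by (simp add: avg_def translate_def)
    finally show "pmf p k *\<^sub>R measure_pmf.expectation (map_pmf (\<lambda>h. k \<otimes> h) q) (\<lambda>k. translate k f x) =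
      pmf p k * translate k (avg q f) x" by simp
  qed simp
  finally show ?thesis by (simp add: avg_def)
qed

lemma avg_bind_pair:
  assumes "m \<noteq> n" and Q: "\<And>i. fin_supp (Q i)"
  shows "avg (bind_pmf (pmf_of_set {m, n :: nat}) Q) f x = (avg (Q m) f x + avg (Q n) f x) / 2"
proof -
  have fin: "finite (set_pmf (bind_pmf (pmf_of_set {m, n}) Q))"
    using Q by (auto simp: fin_supp_def)
  have "avg (bind_pmf (pmf_of_set {m, n}) Q) f x =
      (\<Sum>i\<in>{m, n}. pmf (pmf_of_set {m, n}) i *\<^sub>R measure_pmf.expectation (Q i) (\<lambda>g. translate g f x))"
    unfolding avg_eq_expectation[OF fin]
    by (rule pmf_expectation_bind) (use Q in \<open>auto simp: fin_supp_def\<close>)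
  also have "\<dots> = (avg (Q m) f x + avg (Q n) f x) / 2"
    using assms(1) Q by (simp add: avg_eq_expectation fin_supp_def add_divide_distrib)
  finally show ?thesis .
qed

lemma avg_cong:
  assumes "fin_supp p" "\<And>x. x \<in> space M \<Longrightarrow> f x = h x" "x \<in> space M"
  shows "avg p f x = avg p h x"
  unfolding avg_def translate_def using assms
  by (intro sum.cong) (auto simp: fin_supp_def intro!: assms(2) act_closed)

text \<open>
  If \<open>h\<close> is invariant under a subgroup, its translate by \<open>g\<close> depends only on the left coset of \<open>g\<close>.
\<close>

lemma AE_translate_coset:
  assumes a: "a \<in> carrier G" and g: "g \<in> carrier G"
    and k: "AE x in M. translate (inv a \<otimes> g) h x = h x"
  shows "AE x in M. translate g h x = translate a h x"
proof -
  have "AE x in M. translate (inv a \<otimes> g) h (\<phi> (inv a) x) = h (\<phi> (inv a) x)"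
    using a k by (intro AE_act) auto
  then have "AE x in M. translate a (translate (inv a \<otimes> g) h) x = translate a h x"
    by (simp add: translate_def)
  then show ?thesis
  proof (rule AE_mp, intro AE_I2 impI)
    fix x assume x: "x \<in> space M"
      and eq: "translate a (translate (inv a \<otimes> g) h) x = translate a h x"
    have "a \<otimes> (inv a \<otimes> g) = g" using a g by (simp add: G.m_assoc[symmetric])
    then show "translate g h x = translate a h x"
      using eq x a g translate_mult[of a "inv a \<otimes> g" x h] by simp
  qed
qed

text \<open>
  Truncations of \<open>f\<close> approximate it in \<open>L\<^sup>1\<close>, and both the averages and the conditional
  expectation are \<open>L\<^sup>1\<close> contractions, so the error is uniform in \<open>n\<close>.
\<close>

lemma mean_ergodic_from_bdd:
  assumes p: "\<And>n. fin_supp (p n)"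
    and bd: "\<And>f. bdd_meas f \<Longrightarrow> (\<lambda>n. \<integral>x. \<bar>avg (p n) f x - inv_exp f x\<bar> \<partial>M) \<longlonglongrightarrow> 0"
    and f: "integrable M f"
  shows "(\<lambda>n. \<integral>x. \<bar>avg (p n) f x - inv_exp f x\<bar> \<partial>M) \<longlonglongrightarrow> 0"
proof (rule LIMSEQ_I)
  fix e :: real assume e: "0 < e"
  define t where "t m x = max (- real m) (min (real m) (f x))" for m x
  have fm [measurable]: "f \<in> borel_measurable M" using f by simp
  have tm [measurable]: "t m \<in> borel_measurable M" for m unfolding t_def by measurable
  have tb: "bdd_meas (t m)" for m
    unfolding bdd_meas_def by (auto intro!: exI[of _ "real m"] simp: t_def tm)
  have "(\<lambda>m. \<integral>x. \<bar>f x - t m x\<bar> \<partial>M) \<longlonglongrightarrow> (\<integral>x. 0 \<partial>M)"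
  proof (rule integral_dominated_convergence[where w = "\<lambda>x. 2 * \<bar>f x\<bar>"])
    show "AE x in M. (\<lambda>m. \<bar>f x - t m x\<bar>) \<longlonglongrightarrow> 0"
    proof (rule AE_I2)
      fix x
      obtain m0 :: nat where m0: "\<bar>f x\<bar> \<le> real m0" using real_arch_simple by blast
      have "\<bar>f x - t m x\<bar> = 0" if "m0 \<le> m" for m
        using m0 that by (simp add: t_def min_def max_def abs_le_iff)
      then show "(\<lambda>m. \<bar>f x - t m x\<bar>) \<longlonglongrightarrow> 0"
        by (intro tendsto_eventually) (auto simp: eventually_sequentially)
    qed
    show "AE x in M. norm \<bar>f x - t m x\<bar> \<le> 2 * \<bar>f x\<bar>" for m
      by (rule AE_I2) (auto simp: t_def min_def max_def)
  qed (use f in auto)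
  then obtain m where m: "(\<integral>x. \<bar>f x - t m x\<bar> \<partial>M) < e / 3"
    using LIMSEQ_D[of "\<lambda>m. \<integral>x. \<bar>f x - t m x\<bar> \<partial>M" 0 "e / 3"] e by fastforce
  let ?d = "\<lambda>x. f x - t m x"
  have ti: "integrable M (t m)" using tb by (rule bdd_integrable)
  have di: "integrable M ?d" using f ti by simp
  obtain N where N: "\<And>n. N \<le> n \<Longrightarrow> (\<integral>x. \<bar>avg (p n) (t m) x - inv_exp (t m) x\<bar> \<partial>M) < e / 3"
    using LIMSEQ_D[OF bd[OF tb], of "e / 3" m] e by auto
  have "norm ((\<integral>x. \<bar>avg (p n) f x - inv_exp f x\<bar> \<partial>M) - 0) < e" if n: "N \<le> n" for n
  proof -
    have ints: "integrable M (avg (p n) ?d)" "integrable M (avg (p n) (t m))"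
      "integrable M (avg (p n) f)" "integrable M (inv_exp f)" "integrable M (inv_exp (t m))"
      "integrable M (inv_exp ?d)"
      using f ti di p by (auto intro: avg_integrable I.real_cond_exp_int)
    have "AE x in M. inv_exp ?d x = inv_exp f x - inv_exp (t m) x"
      by (rule I.real_cond_exp_diff[OF f ti])
    then have "AE x in M. \<bar>avg (p n) f x - inv_exp f x\<bar> \<le>
        \<bar>avg (p n) ?d x\<bar> + \<bar>avg (p n) (t m) x - inv_exp (t m) x\<bar> + \<bar>inv_exp ?d x\<bar>"
      by eventually_elim (simp add: avg_diff)
    then have "(\<integral>x. \<bar>avg (p n) f x - inv_exp f x\<bar> \<partial>M) \<le>
        (\<integral>x. \<bar>avg (p n) ?d x\<bar> + \<bar>avg (p n) (t m) x - inv_exp (t m) x\<bar> + \<bar>inv_exp ?d x\<bar> \<partial>M)"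
      using ints by (intro integral_mono_AE) auto
    also have "\<dots> = (\<integral>x. \<bar>avg (p n) ?d x\<bar> \<partial>M) +
        (\<integral>x. \<bar>avg (p n) (t m) x - inv_exp (t m) x\<bar> \<partial>M) + (\<integral>x. \<bar>inv_exp ?d x\<bar> \<partial>M)"
      using ints by simp
    also have "\<dots> < e / 3 + e / 3 + e / 3"
      using L1_avg_le[OF p di, of n] L1_inv_exp_le[OF di] m N[OF n] by linarith
    finally show ?thesis by (simp add: integral_nonneg)
  qed
  then show "\<exists>N. \<forall>n\<ge>N. norm ((\<integral>x. \<bar>avg (p n) f x - inv_exp f x\<bar> \<partial>M) - 0) < e" by blast
qed

end

lemma pmp_systemI: "pmp_action G M \<phi> \<Longrightarrow> pmp_system G M \<phi>"
  by (auto simp: pmp_action_def pmp_system_def pmp_system_axioms_def)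

context alternating_averages
begin

lemma fin_supp_alt_walk: "fin_supp (alt_walk G p q k)"
  by (induction k) (auto intro!: fin_supp_return fin_supp_conv fin)

lemma avg_alt_walk:
  assumes "x \<in> space M"
  shows "avg (alt_walk G p q k) f x = iter f k x"
  using assms
proof (induction k arbitrary: x)
  case 0
  then show ?case by (simp add: avg_return translate_one)
next
  case (Suc k)
  have "avg (alt_walk G p q (Suc k)) f x = avg (alt k) (avg (alt_walk G p q k) f) x"
    using avg_conv[OF alt_fin fin_supp_alt_walk Suc.prems] by (simp add: alt_def)
  also have "\<dots> = avg (alt k) (iter f k) x"
    using Suc by (intro avg_cong alt_fin) auto
  finally show ?case by simp
qed

end

section \<open>Words that stay reduced after folding are geodesic\<close>

type_synonym letter = "surface_gen \<times> bool"

abbreviation flip :: "letter \<Rightarrow> letter" where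
  "flip l \<equiv> (fst l, \<not> snd l)"

text \<open>
  The generator of the free group onto which a letter folds: \<open>True\<close> stands for \<open>x\<close>, the image of
  \<open>a\<close> and \<open>b\<close>, and \<open>False\<close> for \<open>y\<close>, the image of \<open>c\<close> and \<open>d\<close>.
\<close>

definition kind :: "letter \<Rightarrow> bool" where
  "kind l \<longleftrightarrow> fst l \<in> {Gen_a, Gen_b}"

lemma kind_flip [simp]: "kind (flip l) = kind l"
  by (simp add: kind_def)

text \<open>
  The folded images of the two letters do not cancel.
\<close>

definition joinable :: "letter \<Rightarrow> letter \<Rightarrow> bool" where
  "joinable l l' \<longleftrightarrow> kind l \<noteq> kind l' \<or> snd l = snd l'"

lemma joinable_flip: "joinable (flip l') (flip l) \<longleftrightarrow> joinable l l'"
  by (auto simp: joinable_def)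

abbreviation folded_reduced :: "surface_word \<Rightarrow> bool" where
  "folded_reduced w \<equiv> successively joinable w"

lemma word_inv_eq: "word_inv w = rev (map flip w)"
  by (simp add: word_inv_def case_prod_beta')

lemma word_inv_append: "word_inv (u @ v) = word_inv v @ word_inv u"
  by (simp add: word_inv_eq)

lemma folded_reduced_inv: "folded_reduced w \<Longrightarrow> folded_reduced (word_inv w)"
  by (simp add: word_inv_eq successively_map joinable_flip)

text \<open>
  The free group is represented by its left multiplication on reduced words: a letter of the free
  group acts by cancelling the head of the word if possible and by being prefixed otherwise.
\<close>

fun push :: "bool \<times> bool \<Rightarrow> (bool \<times> bool) list \<Rightarrow> (bool \<times> bool) list" where
  "push s [] = [s]"
| "push s (t # w) = (if t = (fst s, \<not> snd s) then w else s # t # w)"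

abbreviation free_reduced :: "(bool \<times> bool) list \<Rightarrow> bool" where
  "free_reduced \<equiv> successively (\<lambda>s t. t \<noteq> (fst s, \<not> snd s))"

lemma free_reduced_push: "free_reduced w \<Longrightarrow> free_reduced (push s w)"
  by (cases w) (auto simp: successively_Cons)

lemma push_push: "free_reduced w \<Longrightarrow> push (t, b) (push (t, \<not> b) w) = w"
  by (cases w rule: list.exhaust; cases "tl w") (auto split: if_splits)

definition fold_letter :: "letter \<Rightarrow> bool \<times> bool" where
  "fold_letter l = (kind l, snd l)"

abbreviation act_word :: "surface_word \<Rightarrow> (bool \<times> bool) list \<Rightarrow> (bool \<times> bool) list" where
  "act_word u w \<equiv> foldr (\<lambda>l. push (fold_letter l)) u w"

lemma free_reduced_act_word: "free_reduced w \<Longrightarrow> free_reduced (act_word u w)"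
  by (induction u) (auto intro: free_reduced_push)

text \<open>
  The action factors through \<open>\<Lambda>\<close>. The relator folds to \<open>x x x\<^sup>-\<^sup>1 x\<^sup>-\<^sup>1 y y y\<^sup>-\<^sup>1 y\<^sup>-\<^sup>1\<close> and
  so acts trivially.
\<close>

lemma act_word_surface_eq:
  assumes "surface_eq u v" "free_reduced w"
  shows "act_word u w = act_word v w"
  using assms
proof (induction arbitrary: w rule: surface_eq.induct)
  case (cancel u x s v)
  have "free_reduced (act_word v w)" by (rule free_reduced_act_word[OF cancel])
  then show ?case using push_push[of _ "kind (x, s)" s] by (simp add: fold_letter_def kind_def)
next
  case (relator u v)
  have "free_reduced (act_word v w)" by (rule free_reduced_act_word[OF relator])
  then have "act_word surface_relator (act_word v w) = act_word v w"
    by (simp add: surface_relator_def word_comm_def word_inv_def fold_letter_def kind_def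
        push_push[of _ _ True, simplified] push_push[of _ _ False, simplified] free_reduced_push)
  then show ?case by simp
qed auto

lemma length_act_word: "length (act_word u w) \<le> length u + length w"
proof (induction u)
  case (Cons l u)
  have "length (push s v) \<le> Suc (length v)" for s v by (cases v) auto
  from order_trans[OF this] Cons show ?case by simp
qed simp

lemma act_word_folded_reduced: "folded_reduced w \<Longrightarrow> act_word w [] = map fold_letter w"
proof (induction w)
  case (Cons l w)
  then show ?case
    by (cases w) (auto simp: fold_letter_def joinable_def successively_Cons)
qed simp

lemma surface_group_simps [simp]:
  "carrier surface_group = UNIV" "mult surface_group = surface_mult" "one surface_group = surface_one"
  by (simp_all add: surface_group_def)

interpretation S: group surface_group by (rule group_surface_group)

abbreviation elt :: "surface_word \<Rightarrow> surface_elt" where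
  "elt \<equiv> abs_surface_elt"

lemma elt_append: "elt (u @ v) = surface_mult (elt u) (elt v)"
  by (simp add: surface_mult.abs_eq)

lemma elt_Nil: "elt [] = surface_one"
  by (simp add: surface_one.abs_eq)

lemma elt_eq_iff: "elt u = elt v \<longleftrightarrow> surface_eq u v"
  by (rule surface_elt.abs_eq_iff)

lemma surj_elt: "surj elt"
  by (rule surjI[of elt rep_surface_elt]) (rule Quotient_abs_rep[OF Quotient_surface_elt])

lemma elt_surj: obtains w where "g = elt w"
  using surj_elt by (rule surjE)

lemma elt_inv: "inv\<^bsub>surface_group\<^esub> (elt w) = elt (word_inv w)"
proof (rule S.inv_equality)
  show "elt (word_inv w) \<otimes>\<^bsub>surface_group\<^esub> elt w = \<one>\<^bsub>surface_group\<^esub>"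
    using word_inv_left[of w] by (simp add: elt_append[symmetric] elt_Nil[symmetric] elt_eq_iff)
qed auto

lemma finite_letters: "finite (UNIV :: letter set)"
proof -
  have "(UNIV :: surface_gen set) = {Gen_a, Gen_b, Gen_c, Gen_d}"
    using surface_gen.exhaust by auto
  then have "finite (UNIV :: surface_gen set)" by (metis finite.emptyI finite.insertI)
  then show ?thesis by (simp add: finite_prod)
qed

lemma countable_surface_elt: "countable (UNIV :: surface_elt set)"
proof -
  have "countable (UNIV :: surface_word set)"
    using countable_lists[OF countable_finite[OF finite_letters]] by (simp add: lists_UNIV)
  then show ?thesis using countable_image[of UNIV elt] by (simp only: surj_elt)
qed

lemma foldr_letters: "foldr surface_mult (map surface_letter w) surface_one = elt w"
  by (induction w) (simp_all add: surface_one.abs_eq surface_letter.abs_eq surface_mult.abs_eq)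

lemma gens_list_eq: "set ss \<subseteq> surface_gens \<longleftrightarrow> (\<exists>w. ss = map surface_letter w)"
  unfolding ex_map_conv surface_gens_def by blast

text \<open>
  Applied to the empty word, \<open>w\<close> produces its folded image, which is as long as \<open>w\<close>. Any other
  word for the same element produces the same result, and each of its letters adds at most one to
  the length.
\<close>

lemma word_norm_folded_reduced:
  assumes "folded_reduced w"
  shows "word_norm surface_group surface_gens (elt w) = length w"
  unfolding word_norm_def
proof (rule Least_equality)
  show "\<exists>ss. length ss = length w \<and> set ss \<subseteq> surface_gens \<and>
      foldr (\<otimes>\<^bsub>surface_group\<^esub>) ss \<one>\<^bsub>surface_group\<^esub> = elt w"
    by (intro exI[of _ "map surface_letter w"]) (auto simp: foldr_letters surface_gens_def)
next
  fix n assume "\<exists>ss. length ss = n \<and> set ss \<subseteq> surface_gens \<and>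
      foldr (\<otimes>\<^bsub>surface_group\<^esub>) ss \<one>\<^bsub>surface_group\<^esub> = elt w"
  then obtain v where v: "length v = n" "elt v = elt w"
    by (auto simp: gens_list_eq foldr_letters)
  have "map fold_letter w = act_word v []"
    using act_word_folded_reduced[OF assms] act_word_surface_eq[of v w "[]"] v
    by (simp add: elt_eq_iff)
  then show "length w \<le> n" using length_act_word[of v "[]"] v by (metis length_map add_0_right list.size(3))
qed

lemma elt_in_sphere:
  assumes "folded_reduced w"
  shows "elt w \<in> word_sphere surface_group surface_gens (length w)"
  using word_norm_folded_reduced[OF assms] S.l_one[of "elt w"]
  by (simp add: word_sphere_def word_dist_def S.inv_one[simplified])

lemma finite_word_sphere: "finite (word_sphere surface_group surface_gens n)"
proof -
  have "word_sphere surface_group surface_gens n \<subseteq>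
      (\<lambda>ss. foldr surface_mult ss surface_one) ` {ss. set ss \<subseteq> surface_gens \<and> length ss = n}"
  proof
    fix g assume "g \<in> word_sphere surface_group surface_gens n"
    then have n: "word_norm surface_group surface_gens g = n"
      using S.l_one[of g] by (simp add: word_sphere_def word_dist_def S.inv_one[simplified])
    obtain ss where "set ss \<subseteq> surface_gens" "foldr surface_mult ss surface_one = g"
      using surface_gens_generate[of g] by auto
    then have "\<exists>m ss. length ss = m \<and> set ss \<subseteq> surface_gens \<and> foldr surface_mult ss surface_one = g"
      by blast
    then have "\<exists>ss. length ss = n \<and> set ss \<subseteq> surface_gens \<and> foldr surface_mult ss surface_one = g"
      unfolding n[symmetric] word_norm_def by (simp only: surface_group_simps) (rule LeastI_ex)
    then show "g \<in> (\<lambda>ss. foldr surface_mult ss surface_one) ` {ss. set ss \<subseteq> surface_gens \<and> length ss = n}"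
      by auto
  qed
  moreover have "finite {ss. set ss \<subseteq> surface_gens \<and> length ss = n}"
    using finite_letters by (intro finite_lists_length_eq) (simp add: surface_gens_def)
  ultimately show ?thesis by (rule finite_subset[OF _ finite_imageI])
qed

section \<open>A random walk along geodesics\<close>

text \<open>
  Length 4 is even, so that the blocks and all their products lie in the subgroup of even words,
  and leaves room for two letters inside a block that can be chosen freely enough for products
  of two blocks to generate that subgroup. Length 2 is too short: a block would
  consist of two letters of one kind and the same sign, and after sending \<open>a, b\<close> to \<open>i\<close> and \<open>c, d\<close>
  to 1, all products of two blocks would become trivial although \<open>c a\<close> does not.
\<close>

definition block :: "bool \<Rightarrow> surface_word set" where
  "block t = {w. length w = 4 \<and> folded_reduced w \<and> kind (hd w) = t \<and> kind (last w) = t}"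

lemma finite_block: "finite (block t)"
proof (rule finite_subset)
  show "block t \<subseteq> {w. set w \<subseteq> UNIV \<and> length w = 4}" by (auto simp: block_def)
qed (rule finite_lists_length_eq[OF finite_letters])

definition std_letter :: "bool \<Rightarrow> letter" where
  "std_letter t = (if t then Gen_a else Gen_c, True)"

lemma kind_std_letter [simp]: "kind (std_letter t) = t"
  by (simp add: kind_def std_letter_def)

lemma joinable_refl [simp]: "joinable l l"
  by (simp add: joinable_def)

lemma joinable_kind: "kind l \<noteq> kind l' \<Longrightarrow> joinable l l'"
  by (simp add: joinable_def)

lemma block_inv: "w \<in> block t \<Longrightarrow> word_inv w \<in> block t"
proof -
  assume w: "w \<in> block t"
  then have "w \<noteq> []" by (auto simp: block_def)
  then have "hd (word_inv w) = flip (last w)" "last (word_inv w) = flip (hd w)"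
    by (simp_all add: word_inv_eq hd_rev last_rev hd_map last_map)
  then show ?thesis
    using w folded_reduced_inv[of w] kind_flip by (simp add: block_def word_inv_eq)
qed

lemma block_const: "replicate 4 (std_letter t) \<in> block t"
  by (simp add: block_def numeral_eq_Suc)

definition step :: "bool \<Rightarrow> surface_elt pmf" where
  "step t = pmf_of_set (elt ` block t)"

lemma set_step: "set_pmf (step t) = elt ` block t"
  unfolding step_def using finite_block block_const by (intro set_pmf_of_set) auto

lemma step_sym: "pmf (step t) (inv\<^bsub>surface_group\<^esub> g) = pmf (step t) g"
proof -
  have inv_in: "inv\<^bsub>surface_group\<^esub> g \<in> elt ` block t" if "g \<in> elt ` block t" for g
    using that block_inv by (auto simp: elt_inv)
  then have "inv\<^bsub>surface_group\<^esub> g \<in> elt ` block t \<longleftrightarrow> g \<in> elt ` block t"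
    using S.inv_inv[of g] inv_in[of "inv\<^bsub>surface_group\<^esub> g"] by auto
  then show ?thesis
    unfolding step_def using finite_block[of t] block_const[of t]
    by (subst (1 2) pmf_of_set) (auto simp: indicator_def)
qed

text \<open>
  The head of the word lies in the block added last, in step \<open>k - 1\<close>, and step \<open>k\<close> prefixes a
  block of the other kind. The two do not cancel, so reducedness persists.
\<close>

lemma set_alt_walk_step:
  assumes "g \<in> set_pmf (alt_walk surface_group (step True) (step False) k)"
  obtains w where "g = elt w" "folded_reduced w" "length w = 4 * k" "w \<noteq> [] \<Longrightarrow> kind (hd w) = odd k"
proof -
  have "\<exists>w. g = elt w \<and> folded_reduced w \<and> length w = 4 * k \<and> (w \<noteq> [] \<longrightarrow> kind (hd w) = odd k)"
    using assms
  proof (induction k arbitrary: g)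
    case 0
    then show ?case by (simp add: elt_Nil)
  next
    case (Suc k)
    let ?t = "even k"
    have "(if even k then step True else step False) = step ?t" by simp
    then obtain g1 g2 where g: "g = surface_mult g1 g2" "g1 \<in> set_pmf (step ?t)"
      "g2 \<in> set_pmf (alt_walk surface_group (step True) (step False) k)"
      using Suc.prems by (auto simp: set_conv_pmf)
    obtain u where u: "g1 = elt u" "u \<in> block ?t" using g(2) by (auto simp: set_step)
    obtain w where w: "g2 = elt w" "folded_reduced w" "length w = 4 * k" "w \<noteq> [] \<longrightarrow> kind (hd w) = odd k"
      using Suc.IH[OF g(3)] by blast
    have "folded_reduced (u @ w)"
      using u w by (auto simp: successively_append_iff block_def joinable_kind)
    moreover have "g = elt (u @ w)" using g u w by (simp add: elt_append)
    moreover have "length (u @ w) = 4 * Suc k" "kind (hd (u @ w)) = odd (Suc k)"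
      using u w by (auto simp: block_def hd_append)
    ultimately show ?case by blast
  qed
  then show thesis using that by blast
qed

text \<open>
  A walk of an even number of steps has length divisible by 8 and starts with a letter over \<open>y\<close>
  unless it is empty, because the factor added last, on the left, comes from an odd step. A power
  of \<open>a\<close> in front of it therefore does not cancel, and it makes up for the remainder of \<open>m\<close> modulo 8.
\<close>

definition padded_walk :: "nat \<Rightarrow> surface_elt pmf" where
  "padded_walk m = conv_pmf surface_group (return_pmf (elt (replicate (m mod 8) (std_letter True))))
     (alt_walk surface_group (step True) (step False) (2 * (m div 8)))"

lemma set_padded_walk: "set_pmf (padded_walk m) \<subseteq> word_sphere surface_group surface_gens m"
proof
  fix g assume "g \<in> set_pmf (padded_walk m)"
  then obtain h where g: "g = surface_mult (elt (replicate (m mod 8) (std_letter True))) h"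
    and h: "h \<in> set_pmf (alt_walk surface_group (step True) (step False) (2 * (m div 8)))"
    by (auto simp: padded_walk_def set_conv_pmf)
  obtain w where w: "h = elt w" "folded_reduced w" "length w = 4 * (2 * (m div 8))"
    "w \<noteq> [] \<Longrightarrow> kind (hd w) = odd (2 * (m div 8))"
    using set_alt_walk_step[OF h] by blast
  let ?v = "replicate (m mod 8) (std_letter True) @ w"
  have "folded_reduced (replicate n (std_letter True))" for n
  proof (induction n)
    case (Suc n)
    then show ?case by (cases n) auto
  qed simp
  then have "folded_reduced ?v"
    using w by (cases "w = []"; cases "m mod 8 = 0") (auto simp: successively_append_iff joinable_kind)
  moreover have "length ?v = m" using w by simp
  ultimately show "g \<in> word_sphere surface_group surface_gens m"
    using elt_in_sphere[of ?v] g w by (simp add: elt_append)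
qed

definition surface_averages :: "nat \<Rightarrow> surface_elt pmf" where
  "surface_averages n = bind_pmf (pmf_of_set {n, n + 1}) padded_walk"

lemma set_surface_averages:
  "set_pmf (surface_averages n) \<subseteq>
    word_sphere surface_group surface_gens n \<union> word_sphere surface_group surface_gens (n + 1)"
  using set_padded_walk by (fastforce simp: surface_averages_def)

section \<open>Products of two blocks generate the even words\<close>

abbreviation block_group :: "surface_elt set" where
  "block_group \<equiv> return_group surface_group (step True) (step False)"

lemma subgroup_block_group: "subgroup block_group surface_group"
  unfolding return_group_def by (rule S.generate_is_subgroup) simp

lemma block_group_append: "elt u \<in> block_group \<Longrightarrow> elt v \<in> block_group \<Longrightarrow> elt (u @ v) \<in> block_group"
  using subgroup.m_closed[OF subgroup_block_group] by (simp add: elt_append)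

lemma block_group_inv: "elt u \<in> block_group \<Longrightarrow> elt (word_inv u) \<in> block_group"
  using subgroup.m_inv_closed[OF subgroup_block_group] by (metis elt_inv)

lemma block_group_Nil: "elt [] \<in> block_group"
  using subgroup.one_closed[OF subgroup_block_group] by (simp add: elt_Nil)

lemma block_group_left_cancel:
  assumes "elt (u @ v) \<in> block_group" "elt u \<in> block_group"
  shows "elt v \<in> block_group"
proof -
  have "elt (word_inv u @ (u @ v)) \<in> block_group"
    using assms(1) block_group_inv[OF assms(2)] by (rule block_group_append[rotated])
  moreover have "surface_eq (word_inv u @ (u @ v)) v"
    using surface_eq_append[OF word_inv_left[of u] surface_eq.refl[of v]] by simp
  ultimately show ?thesis by (metis elt_eq_iff)
qed

lemma block_group_right_cancel:
  assumes "elt (u @ v) \<in> block_group" "elt v \<in> block_group"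
  shows "elt u \<in> block_group"
proof -
  have "elt (word_inv v @ word_inv u) \<in> block_group"
    using block_group_inv[OF assms(1)] by (simp add: word_inv_append)
  from block_group_left_cancel[OF this block_group_inv[OF assms(2)]]
  show ?thesis using block_group_inv[of "word_inv u"] by (simp add: word_inv_invol)
qed

lemma block_group_blocks:
  assumes "u \<in> block t" "v \<in> block t"
  shows "elt (u @ v) \<in> block_group"
  unfolding return_group_def
proof (rule generate.incl)
  show "elt (u @ v) \<in> {g \<otimes>\<^bsub>surface_group\<^esub> h |g h. g \<in> set_pmf (step True) \<and> h \<in> set_pmf (step True)} \<union>
     {g \<otimes>\<^bsub>surface_group\<^esub> h |g h. g \<in> set_pmf (step False) \<and> h \<in> set_pmf (step False)}"
  proof -
    have eq: "elt (u @ v) = elt u \<otimes>\<^bsub>surface_group\<^esub> elt v"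
      by (simp add: elt_append)
    have "elt u \<in> set_pmf (step t)" "elt v \<in> set_pmf (step t)"
      using assms by (auto simp: set_step)
    then have "elt (u @ v) \<in> {g \<otimes>\<^bsub>surface_group\<^esub> h |g h. g \<in> set_pmf (step t) \<and> h \<in> set_pmf (step t)}"
      unfolding eq by blast
    then show ?thesis by (cases t) (simp_all only: Un_iff simp_thms)
  qed
qed

lemma surface_eq_insert: "surface_eq (u @ word_inv x @ x @ v) (u @ v)"
  using surface_eq_context[OF word_inv_left[of x], of u v] by simp

text \<open>
  Two blocks that differ only in the last letter have a quotient of length 2, and that last letter
  is an arbitrary letter of the kind of the block.
\<close>

lemma block_group_same_kind:
  assumes "kind r = t" "kind r' = t"
  shows "elt [r, r'] \<in> block_group"
proof -
  let ?x = "[std_letter t, std_letter (\<not> t), std_letter (\<not> t)]"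
  have "?x @ [flip r] \<in> block t" "?x @ [r'] \<in> block t"
    using assms by (auto simp: block_def joinable_kind)
  then have "elt (word_inv (?x @ [flip r]) @ (?x @ [r'])) \<in> block_group"
    by (intro block_group_blocks block_inv)
  moreover have "word_inv (?x @ [flip r]) @ (?x @ [r']) = [r] @ word_inv ?x @ ?x @ [r']"
    by (simp add: word_inv_eq)
  ultimately show ?thesis
    using surface_eq_insert[of "[r]" ?x "[r']"] by (metis append_Cons append_Nil elt_eq_iff)
qed

text \<open>
  The product of the blocks \<open>a a c a\<close> and \<open>a a a a\<close> is \<open>c a\<close> up to factors \<open>a a\<close>, which are
  covered by \<open>block_group_same_kind\<close>.
\<close>

lemma block_group_ca: "elt [std_letter False, std_letter True] \<in> block_group"
proof -
  let ?a = "std_letter True" and ?c = "std_letter False"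
  have aa: "elt [?a, ?a] \<in> block_group" by (rule block_group_same_kind) auto
  have "elt ([?a, ?a, ?c, ?a] @ [?a, ?a, ?a, ?a]) \<in> block_group"
    by (rule block_group_blocks[of _ True]) (auto simp: block_def joinable_kind)
  then have "elt ([?a, ?a] @ [?c, ?a] @ [?a, ?a] @ [?a, ?a]) \<in> block_group" by simp
  then have "elt (([?c, ?a] @ [?a, ?a]) @ [?a, ?a]) \<in> block_group"
    using block_group_left_cancel[OF _ aa] by simp
  then show ?thesis using block_group_right_cancel[OF block_group_right_cancel[OF _ aa] aa] by blast
qed

lemma block_group_mixed:
  assumes "\<not> kind q" "kind r"
  shows "elt [q, r] \<in> block_group"
proof -
  let ?a = "std_letter True" and ?c = "std_letter False"
  have "elt [q, flip ?c] \<in> block_group" "elt [flip ?a, r] \<in> block_group"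
    using assms by (auto intro!: block_group_same_kind)
  then have "elt ([q, flip ?c] @ [?c, ?a] @ [flip ?a, r]) \<in> block_group"
    by (intro block_group_append block_group_ca)
  moreover have "surface_eq ([q, flip ?c] @ [?c, ?a] @ [flip ?a, r]) [q, r]"
  proof (rule surface_eq.trans)
    show "surface_eq ([q, flip ?c] @ [?c, ?a] @ [flip ?a, r]) ([q, flip ?c] @ [?c] @ [r])"
      using surface_eq_insert[of "[q, flip ?c, ?c]" "[flip ?a]" "[r]"] by (simp add: word_inv_eq)
    show "surface_eq ([q, flip ?c] @ [?c] @ [r]) [q, r]"
      using surface_eq_insert[of "[q]" "[?c]" "[r]"] by (simp add: word_inv_eq)
  qed
  ultimately show ?thesis by (metis elt_eq_iff)
qed

lemma block_group_pair: "elt [q, r] \<in> block_group"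
proof -
  consider "kind q = kind r" | "\<not> kind q" "kind r" | "kind q" "\<not> kind r" by blast
  then show ?thesis
  proof cases
    case 3
    then have "elt (word_inv [flip r, flip q]) \<in> block_group"
      by (intro block_group_inv block_group_mixed) auto
    then show ?thesis by (simp add: word_inv_eq)
  qed (auto intro: block_group_same_kind block_group_mixed)
qed

lemma block_group_even: "even (length w) \<Longrightarrow> elt w \<in> block_group"
proof (induction w rule: induct_list012)
  case (3 q r w)
  then show ?case using block_group_append[OF block_group_pair[of q r], of w] by simp
qed (auto simp: block_group_Nil)

section \<open>Convergence for the surface group\<close>

lemma even_mod_8: "even (m mod 8) \<longleftrightarrow> even (m :: nat)"
  by presburger

lemma fin_supp_surface_averages:
  assumes "pmp_system surface_group M \<phi>"
  shows "pmp_system.fin_supp surface_group (surface_averages n)"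
proof -
  interpret pmp_system surface_group M \<phi> by fact
  have "finite (set_pmf (surface_averages n))"
    by (rule finite_subset[OF set_surface_averages]) (simp add: finite_word_sphere)
  then show ?thesis by (simp add: fin_supp_def)
qed

text \<open>
  With \<open>h\<close> the limit of the alternating averages, left multiplication by an even element fixes \<open>h\<close>
  and by an odd element turns it into \<open>a h\<close>. Every element of \<open>\<Lambda>\<close> fixes or exchanges \<open>h\<close> and
  \<open>a h\<close>, and so fixes their mean.
\<close>

lemma surface_averages_converge:
  assumes "pmp_system surface_group M \<phi>" and "pmp_system.bdd_meas M f"
  shows "(\<lambda>n. \<integral>x. \<bar>pmp_system.avg surface_group \<phi> (surface_averages n) f x -
      real_cond_exp M (invariant_algebra surface_group M \<phi>) f x\<bar> \<partial>M) \<longlonglongrightarrow> 0"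
proof -
  interpret pmp_system surface_group M \<phi> by fact
  note f = assms(2)
  have fin: "fin_supp (step t)" for t
    using finite_block by (simp add: fin_supp_def set_step)
  interpret alternating_averages surface_group M \<phi> "step True" "step False"
    by standard (auto simp: fin symmetric_def step_sym)
  have even: "elt w \<in> block_group" if "even (length w)" for w
    using that by (rule block_group_even)
  have meets: "set_pmf (step t) \<inter> block_group \<noteq> {}" for t
    using block_const[of t] even[of "replicate 4 (std_letter t)"] by (auto simp: set_step)
  obtain h where h: "integrable M h" "(\<lambda>k. \<integral>x. \<bar>iter f k x - h x\<bar> \<partial>M) \<longlonglongrightarrow> 0"
    "\<And>g. g \<in> block_group \<Longrightarrow> AE x in M. translate g h x = h x"
    using alternating_limit[OF f meets meets] by blast
  define a where "a = elt [std_letter True]"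
  define h' where "h' x = (h x + translate a h x) / 2" for x
  let ?inv = "\<lambda>g. inv\<^bsub>surface_group\<^esub> g"
  have ha: "integrable M (translate a h)" using h(1) by (intro translate_integrable) auto
  have h'i: "integrable M h'" unfolding h'_def using h(1) ha by simp
  have inv_a: "?inv a = elt [flip (std_letter True)]"
    by (simp add: a_def elt_inv word_inv_eq)
  have even_tr: "AE x in M. translate (elt w) h x = h x" if "even (length w)" for w
    using that by (intro h(3) even)
  have odd_tr: "AE x in M. translate (elt w) h x = translate a h x" if "odd (length w)" for w
  proof (rule AE_translate_coset)
    have "?inv a \<otimes>\<^bsub>surface_group\<^esub> elt w = elt (flip (std_letter True) # w)"
      using elt_append[of "[flip (std_letter True)]" w] by (simp add: inv_a)
    then show "AE x in M. translate (?inv a \<otimes>\<^bsub>surface_group\<^esub> elt w) h x = h x"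
      using even_tr[of "flip (std_letter True) # w"] that by simp
  qed auto
  have h'_inv: "AE x in M. h' (\<phi> g x) = h' x" for g
  proof -
    obtain w where w: "?inv g = elt w" by (rule elt_surj)
    have tr_eq: "translate (elt w) (translate a h) x = translate (elt (w @ [std_letter True])) h x"
      if "x \<in> space M" for x
      using translate_mult[of "elt w" a x h] that by (simp add: elt_append a_def)
    have h'_tr: "h' (\<phi> g x) = (translate (elt w) h x + translate (elt (w @ [std_letter True])) h x) / 2"
      if "x \<in> space M" for x
    proof -
      have "g = ?inv (elt w)" using w by (metis S.inv_inv UNIV_I surface_group_simps(1))
      then show ?thesis using tr_eq[OF that] by (simp add: h'_def translate_def)
    qed
    show ?thesis
    proof (cases "even (length w)")
      case True
      then have "AE x in M. translate (elt w) h x = h x"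
        "AE x in M. translate (elt (w @ [std_letter True])) h x = translate a h x"
        by (auto intro!: even_tr odd_tr)
      then show ?thesis using AE_space by eventually_elim (simp add: h'_tr, simp add: h'_def)
    next
      case False
      then have "AE x in M. translate (elt w) h x = translate a h x"
        "AE x in M. translate (elt (w @ [std_letter True])) h x = h x"
        by (auto intro!: even_tr odd_tr)
      then show ?thesis using AE_space by eventually_elim (simp add: h'_tr, simp add: h'_def)
    qed
  qed
  \<comment> \<open>\<open>z m\<close> is the limit of the averages of length \<open>m\<close>: the padding is an even or an odd power
    of \<open>a\<close> according to the parity of \<open>m\<close>.\<close>
  define z where "z m = (if even m then h else translate a h)" for m :: nat
  have zi: "integrable M (z m)" for m using h(1) ha by (simp add: z_def)
  have pfin: "fin_supp (padded_walk m)" for m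
    unfolding padded_walk_def by (intro fin_supp_conv fin_supp_return fin_supp_alt_walk) auto
  have pint: "integrable M (avg (padded_walk m) f)" for m
    using pfin f by (intro avg_integrable bdd_integrable)
  define E where "E m = (\<integral>x. \<bar>avg (padded_walk m) f x - z m x\<bar> \<partial>M)" for m
  have E: "E m = (\<integral>x. \<bar>iter f (2 * (m div 8)) x - h x\<bar> \<partial>M)" for m
  proof -
    let ?v = "replicate (m mod 8) (std_letter True)"
    let ?i = "iter f (2 * (m div 8))"
    have "avg (padded_walk m) f x = translate (elt ?v) ?i x" if "x \<in> space M" for x
    proof -
      have "avg (padded_walk m) f x =
          avg (return_pmf (elt ?v)) (avg (alt_walk surface_group (step True) (step False) (2 * (m div 8))) f) x"
        unfolding padded_walk_def using that
        by (intro avg_conv fin_supp_return fin_supp_alt_walk) auto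
      then show ?thesis
        using that act_closed[of "?inv (elt ?v)" x] avg_alt_walk
        by (simp add: avg_return translate_def)
    qed
    moreover have "AE x in M. z m x = translate (elt ?v) h x"
    proof (cases "even m")
      case True
      then have "even (length ?v)" by (simp add: even_mod_8)
      from even_tr[OF this] show ?thesis using True by (simp add: z_def eq_commute)
    next
      case False
      then have "odd (length ?v)" by (simp add: even_mod_8)
      from odd_tr[OF this] show ?thesis using False by (simp add: z_def eq_commute)
    qed
    ultimately have "AE x in M. \<bar>avg (padded_walk m) f x - z m x\<bar> =
        \<bar>translate (elt ?v) ?i x - translate (elt ?v) h x\<bar>"
      using AE_space by (auto elim!: eventually_elim2)
    then have "E m = (\<integral>x. \<bar>translate (elt ?v) ?i x - translate (elt ?v) h x\<bar> \<partial>M)"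
      unfolding E_def using pint zi h(1) bdd_integrable[OF bdd_iter[OF f]]
      by (intro integral_cong_AE) (auto intro!: borel_measurable_integrable translate_integrable
          borel_measurable_abs borel_measurable_diff)
    also have "\<dots> = (\<integral>x. \<bar>?i x - h x\<bar> \<partial>M)"
      using h(1) bdd_measurable[OF bdd_iter[OF f]] by (intro L1_translate) auto
    finally show ?thesis .
  qed
  have "E \<longlonglongrightarrow> 0"
  proof -
    have "filterlim (\<lambda>m::nat. 2 * (m div 8)) sequentially sequentially"
    proof (rule filterlim_at_top_mono)
      show "filterlim (\<lambda>m::nat. m div 8) sequentially sequentially"
        by (rule filterlim_at_top_div_const_nat) simp
    qed auto
    from filterlim_compose[OF h(2) this] show ?thesis by (simp add: E [abs_def])
  qed
  have "(\<lambda>n. \<integral>x. \<bar>avg (surface_averages n) f x - h' x\<bar> \<partial>M) \<longlonglongrightarrow> 0"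
  proof (rule squeeze_to_0)
    have "(\<lambda>n. (E n + E (Suc n)) / 2) \<longlonglongrightarrow> (0 + 0) / 2"
      using \<open>E \<longlonglongrightarrow> 0\<close> LIMSEQ_Suc[OF \<open>E \<longlonglongrightarrow> 0\<close>] by (intro tendsto_divide tendsto_add) auto
    then show "(\<lambda>n. (E n + E (Suc n)) / 2) \<longlonglongrightarrow> 0" by simp
    fix n
    show "0 \<le> (\<integral>x. \<bar>avg (surface_averages n) f x - h' x\<bar> \<partial>M)" by simp
    have a: "avg (surface_averages n) f x = (avg (padded_walk n) f x + avg (padded_walk (Suc n)) f x) / 2" for x
      unfolding surface_averages_def using avg_bind_pair[of n "Suc n" padded_walk f x] pfin by simp
    have b: "h' x = (z n x + z (Suc n) x) / 2" for x by (simp add: h'_def z_def)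
    have i: "integrable M (\<lambda>x. \<bar>avg (padded_walk m) f x - z m x\<bar>)" for m using pint zi by auto
    have abs_half: "\<bar>(r + s) / 2 - (t + u) / 2\<bar> \<le> (\<bar>r - t\<bar> + \<bar>s - u\<bar>) / 2" for r s t u :: real
      by argo
    have "(\<integral>x. \<bar>avg (surface_averages n) f x - h' x\<bar> \<partial>M) \<le>
        (\<integral>x. (\<bar>avg (padded_walk n) f x - z n x\<bar> + \<bar>avg (padded_walk (Suc n)) f x - z (Suc n) x\<bar>) / 2 \<partial>M)"
    proof (rule integral_mono)
      show "integrable M (\<lambda>x. \<bar>avg (surface_averages n) f x - h' x\<bar>)"
        unfolding a using pint h'i by auto
      show "integrable M (\<lambda>x. (\<bar>avg (padded_walk n) f x - z n x\<bar> + \<bar>avg (padded_walk (Suc n)) f x - z (Suc n) x\<bar>) / 2)"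
        using i by auto
      show "\<bar>avg (surface_averages n) f x - h' x\<bar> \<le>
          (\<bar>avg (padded_walk n) f x - z n x\<bar> + \<bar>avg (padded_walk (Suc n)) f x - z (Suc n) x\<bar>) / 2" for x
        unfolding a b by (rule abs_half)
    qed
    also have "\<dots> = (E n + E (Suc n)) / 2" using i by (simp add: E_def)
    finally show "(\<integral>x. \<bar>avg (surface_averages n) f x - h' x\<bar> \<partial>M) \<le> (E n + E (Suc n)) / 2" .
  qed
  then show ?thesis
    using fin_supp_surface_averages[OF assms(1)] h'_inv bdd_integrable[OF f] h'i countable_surface_elt
    by (intro invariant_limit_is_inv_exp) auto
qed

lemma L1_mean_ergodic_surface_averages:
  assumes "pmp_action surface_group M \<phi>"
  shows "L1_mean_ergodic_on surface_group surface_averages M \<phi>"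
proof -
  interpret pmp_system surface_group M \<phi> by (rule pmp_systemI[OF assms])
  note fin = fin_supp_surface_averages[OF pmp_system_axioms]
  show ?thesis
    unfolding L1_mean_ergodic_on_def group_average_eq_avg[OF fin]
    using avg_integrable[OF fin]
      mean_ergodic_from_bdd[OF fin surface_averages_converge[OF pmp_system_axioms]]
    by blast
qed

section \<open>Independence of the underlying space\<close>

definition shift :: "('g, 'b) monoid_scheme \<Rightarrow> 'g \<Rightarrow> ('g \<Rightarrow> real) \<Rightarrow> 'g \<Rightarrow> real" where
  "shift G g \<omega> = (\<lambda>k. \<omega> (inv\<^bsub>G\<^esub> g \<otimes>\<^bsub>G\<^esub> k))"

lemma group_action_shift:
  fixes G (structure)
  assumes "group G" and UNIV: "carrier G = UNIV"
  shows "group_action G UNIV (shift G)"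
proof -
  interpret group G by fact
  have mult: "shift G (g \<otimes> k) = shift G g \<circ> shift G k" for g k
    using UNIV by (simp add: shift_def fun_eq_iff inv_mult_group m_assoc)
  have one: "shift G \<one> = id" using UNIV by (simp add: shift_def fun_eq_iff)
  have bij: "shift G g \<in> Bij UNIV" for g
    unfolding Bij_def
    using o_bij[of "shift G (inv g)" "shift G g"] mult[of g "inv g"] mult[of "inv g" g] one UNIV
    by simp
  show ?thesis
    unfolding group_action_def group_hom_def group_hom_axioms_def
    using group_BijGroup bij mult
    by (auto intro!: homI simp: BijGroup_def compose_def fun_eq_iff is_group)
qed

text \<open>
  The orbit map \<open>\<Phi>\<close> of \<open>f\<close> is equivariant, so the image of the measure is invariant under the
  shift, and \<open>f\<close> is \<open>\<Phi>\<close> followed by evaluation at the identity. The conditional expectation of the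
  evaluation, composed with \<open>\<Phi>\<close>, is an invariant \<open>L\<^sup>1\<close> limit of the averages of \<open>f\<close>. That it is
  the conditional expectation of \<open>f\<close> is not automatic, since \<open>M\<close> may have more invariant sets than
  those pulled back by \<open>\<Phi>\<close>; it follows from \<open>invariant_limit_is_inv_exp\<close>.
\<close>

lemma L1_mean_ergodic_transfer:
  fixes G (structure) and M :: "'x measure"
  assumes UNIV: "carrier G = (UNIV :: 'g set)" and count: "countable (UNIV :: 'g set)"
    and fin: "\<And>n. finite (set_pmf (\<pi> n))"
    and erg: "\<And>(N :: ('g \<Rightarrow> real) measure) \<psi>. pmp_action G N \<psi> \<Longrightarrow> L1_mean_ergodic_on G \<pi> N \<psi>"
    and act: "pmp_action G M \<phi>"
  shows "L1_mean_ergodic_on G \<pi> M \<phi>"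
  unfolding L1_mean_ergodic_on_def
proof (intro allI impI conjI)
  fix f :: "'x \<Rightarrow> real" assume f: "integrable M f"
  interpret pmp_system G M \<phi> by (rule pmp_systemI[OF act])
  have fs: "fin_supp (\<pi> n)" for n using fin UNIV by (simp add: fin_supp_def)
  show "integrable M (group_average G (\<pi> n) \<phi> f)" for n
    unfolding group_average_eq_avg[OF fs] by (rule avg_integrable[OF fs f])
  have fm [measurable]: "f \<in> borel_measurable M" using f by simp
  let ?P = "PiM UNIV (\<lambda>_::'g. borel :: real measure)"
  define \<Phi> where "\<Phi> x = (\<lambda>k. f (\<phi> (inv k) x))" for x
  have \<Phi> [measurable]: "\<Phi> \<in> measurable M ?P"
    unfolding \<Phi>_def
  proof (rule measurable_PiM_single')
    show "(\<lambda>x. f (\<phi> (inv k) x)) \<in> borel_measurable M" for k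
      using translate_measurable[of k f] UNIV fm by (simp add: translate_def [abs_def])
  qed (auto simp: space_PiM)
  have shift_meas [measurable]: "shift G g \<in> measurable ?P ?P" for g
    unfolding shift_def
    by (rule measurable_PiM_single') (auto simp: space_PiM)
  have equi: "shift G g (\<Phi> x) = \<Phi> (\<phi> g x)" if "x \<in> space M" for g x
  proof
    fix k
    have "inv (inv g \<otimes> k) = inv k \<otimes> g" using UNIV by (simp add: G.inv_mult_group)
    then show "shift G g (\<Phi> x) k = \<Phi> (\<phi> g x) k"
      using that UNIV by (simp add: shift_def \<Phi>_def composition_rule)
  qed
  define N where "N = distr M ?P \<Phi>"
  have spN: "space N = UNIV" by (simp add: N_def space_PiM)
  have N_act: "pmp_action G N (shift G)"
    unfolding pmp_action_def
  proof (intro conjI ballI)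
    show "prob_space N" unfolding N_def by (rule prob_space_distr) simp
    show "group_action G (space N) (shift G)"
      unfolding spN by (rule group_action_shift[OF G.is_group UNIV])
    fix g assume g: "g \<in> carrier G"
    show "shift G g \<in> measurable N N" by (simp add: N_def)
    have "distr N N (shift G g) = distr M ?P (shift G g \<circ> \<Phi>)"
      unfolding N_def by (subst distr_distr[symmetric]) (auto intro: distr_cong)
    also have "\<dots> = distr M ?P (\<Phi> \<circ> \<phi> g)"
      by (rule distr_cong) (auto simp: equi)
    also have "\<dots> = distr (distr M M (\<phi> g)) ?P \<Phi>"
      using measurable_act[OF g] by (subst distr_distr) auto
    also have "\<dots> = N" using g by (simp add: distr_act N_def)
    finally show "distr N N (shift G g) = N" .
  qed
  interpret N: pmp_system G N "shift G" by (rule pmp_systemI[OF N_act])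
  define F where "F \<omega> = \<omega> \<one>" for \<omega> :: "'g \<Rightarrow> real"
  have Fm [measurable]: "F \<in> borel_measurable ?P" unfolding F_def by measurable
  have F\<Phi>: "F (\<Phi> x) = f x" if "x \<in> space M" for x
    using that by (simp add: F_def \<Phi>_def act_one)
  have Fi: "integrable N F"
    unfolding N_def by (subst integrable_distr_eq) (auto simp: F\<Phi> f cong: Bochner_Integration.integrable_cong)
  have avg_eq: "N.avg p F (\<Phi> x) = avg p f x" for p x
    using UNIV by (simp add: N.avg_def avg_def N.translate_def translate_def F_def shift_def \<Phi>_def)
  have conv: "(\<lambda>n. \<integral>\<omega>. \<bar>N.avg (\<pi> n) F \<omega> - N.inv_exp F \<omega>\<bar> \<partial>N) \<longlonglongrightarrow> 0"
    using erg[OF N_act] Fi fs by (simp add: L1_mean_ergodic_on_def N.group_average_eq_avg)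
  define h where "h x = N.inv_exp F (\<Phi> x)" for x
  have Em [measurable]: "N.inv_exp F \<in> borel_measurable ?P"
    using N.I.real_cond_exp_int(1)[OF Fi] by (simp add: N_def)
  have hi: "integrable M h"
    using N.I.real_cond_exp_int(1)[OF Fi] unfolding N_def h_def
    by (subst (asm) integrable_distr_eq) auto
  have "(\<integral>\<omega>. \<bar>N.avg (\<pi> n) F \<omega> - N.inv_exp F \<omega>\<bar> \<partial>N) = (\<integral>x. \<bar>avg (\<pi> n) f x - h x\<bar> \<partial>M)" for n
  proof -
    have m: "N.avg (\<pi> n) F \<in> borel_measurable ?P"
      using N.avg_integrable[OF fs Fi, of n] by (simp add: N_def)
    show ?thesis
      unfolding h_def avg_eq[symmetric] N_def
      by (rule integral_distr) (use m Em in \<open>auto simp: N_def\<close>)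
  qed
  then have lim: "(\<lambda>n. \<integral>x. \<bar>avg (\<pi> n) f x - h x\<bar> \<partial>M) \<longlonglongrightarrow> 0" using conv by simp
  have "h (\<phi> g x) = h x" if "g \<in> carrier G" "x \<in> space M" for g x
  proof -
    have "N.inv_exp F (shift G g (\<Phi> x)) = N.inv_exp F (\<Phi> x)"
      by (rule N.invariant_measurable_act) (use that in \<open>auto simp: spN\<close>)
    then show ?thesis using equi that by (simp add: h_def)
  qed
  then have "AE x in M. h (\<phi> g x) = h x" if "g \<in> carrier G" for g
    using that by (intro AE_I2)
  from invariant_limit_is_inv_exp[OF _ f hi fs this lim]
  show "(\<lambda>n. \<integral>x. \<bar>group_average G (\<pi> n) \<phi> f x - inv_exp f x\<bar> \<partial>M) \<longlonglongrightarrow> 0"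
    using count UNIV by (simp add: group_average_eq_avg[OF fs])
qed

text \<open>
  The explicit measures show that the choice defining \<open>surface_seq\<close> is not void. The chosen
  sequence may be another one, so only its defining property for the one function space is used
  from there on.
\<close>

theorem corollary1p3:
  shows "(\<forall>n. set_pmf (surface_seq n) \<subseteq> word_sphere surface_group surface_gens n
                                       \<union> word_sphere surface_group surface_gens (n + 1)) \<and>
         (\<forall>(M :: 'x measure) \<phi>. pmp_action surface_group M \<phi> \<longrightarrow>
            L1_mean_ergodic_on surface_group surface_seq M \<phi>)"
proof -
  have spec: "(\<forall>n. set_pmf (surface_seq n) \<subseteq> word_sphere surface_group surface_gens n
                         \<union> word_sphere surface_group surface_gens (n + 1)) \<and>
     (\<forall>(M :: (surface_elt \<Rightarrow> real) measure) \<phi>.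
        pmp_action surface_group M \<phi> \<longrightarrow> L1_mean_ergodic_on surface_group surface_seq M \<phi>)"
    unfolding surface_seq_def
  proof (rule someI[of _ surface_averages], intro conjI allI impI)
    show "set_pmf (surface_averages n) \<subseteq> word_sphere surface_group surface_gens n
        \<union> word_sphere surface_group surface_gens (n + 1)" for n
      by (rule set_surface_averages)
    show "L1_mean_ergodic_on surface_group surface_averages M \<phi>"
      if "pmp_action surface_group M \<phi>" for M :: "(surface_elt \<Rightarrow> real) measure" and \<phi>
      using that by (rule L1_mean_ergodic_surface_averages)
  qed
  have "finite (set_pmf (surface_seq n))" for n
    by (rule finite_subset[OF conjunct1[OF spec, rule_format]]) (simp add: finite_word_sphere)
  then have "L1_mean_ergodic_on surface_group surface_seq M \<phi>"
    if "pmp_action surface_group M \<phi>" for M :: "'x measure" and \<phi>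
    using L1_mean_ergodic_transfer[OF _ countable_surface_elt _ conjunct2[OF spec, rule_format] that]
    by simp
  with conjunct1[OF spec] show ?thesis by simp
qed

end
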